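(* Let $(\Omega_1,\{\theta_{1,t}\}_{t\in\mathbb{R}})$ and $(\Omega_2,\mathcal{F}_2,P,\{\theta_{2,t}\}_{t\in\mathbb{R}})$ be parametric dynamical systems and let $\Phi:\mathbb{R}^+\times\Omega_1\times\Omega_2\times\ell^2\to\ell^2$ be a continuous cocycle on $\ell^2$ over them. Suppose that (a) there exists a closed measurable (with respect to the $P$-completion of $\mathcal{F}_2$) $\mathcal{D}(\ell^2)$-pullback absorbing set $K=\{K(\omega_1,\omega_2)\}$ in $\mathcal{D}(\ell^2)$ such that for a.e. $\omega_1\in\Omega_1$, $\omega_2\in\Omega_2$ and any $B=\{B(\omega_1,\omega_2)\}\in\mathcal{D}(\ell^2)$ there exists $T_B(\omega_1,\omega_2)>0$ with $$\Phi(t,\theta_{1,-t}\omega_1,\theta_{2,-t}\omega_2,B(\theta_{1,-t}\omega_1,\theta_{2,-t}\omega_2))\subset K(\omega_1,\omega_2)\quad\text{for all } t\ge T_B(\omega_1,\omega_2);$$ (b) $\Phi$ is asymptotically null on $K$, i.e., for a.e. $\omega_1\in\Omega_1$, $\omega_2\in\Omega_2$ and any $\varepsilon>0$ there exist $T(\varepsilon,\omega_1,\omega_2,K)>0$ and $I_0(\varepsilon,\omega_1,\omega_2,K)\in\mathbb{N}$ such that $$\sup_{u\in K(\theta_{1,-t}\omega_1,\theta_{2,-t}\omega_2)}\ \sum_{|i|>I_0(\varepsilon,\omega_1,\omega_2,K)}\big|(\Phi(t,\theta_{1,-t}\omega_1,\theta_{2,-t}\omega_2,u))_i\big|^2\le\varepsilon^2\quad\text{for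 all } t\ge T(\varepsilon,\omega_1,\omega_2,K).$$ Then: (i) $\Phi$ possesses a unique $\mathcal{D}(\ell^2)$-pullback attractor $\mathcal{A}=\{\mathcal{A}(\omega_1,\omega_2)\}$, given for each $\omega_1\in\Omega_1$ and $\omega_2\in\Omega_2$ by $$\mathcal{A}(\omega_1,\omega_2)=\bigcap_{\tau\ge T_K(\omega_1,\omega_2)}\overline{\bigcup_{t\ge\tau}\Phi(t,\theta_{1,-t}\omega_1,\theta_{2,-t}\omega_2,K(\theta_{1,-t}\omega_1,\theta_{2,-t}\omega_2))},$$ where $T_K(\omega_1,\omega_2)$ is the time from (a) for $B=K$; (ii) the Kolmogorov $\varepsilon$-entropy of $\mathcal{A}(\omega_1,\omega_2)$ satisfies $$\mathbb{K}_\varepsilon(\mathcal{A}(\omega_1,\omega_2))\le(2I_0+1)\ln\left(\left\lfloor\frac{2r_0(\omega_1,\omega_2)\sqrt{2I_0+1}}{\varepsilon}\right\rfloor+1\right),\qquad I_0=I_0(\varepsilon,\omega_1,\omega_2,K),$$ where $r_0(\omega_1,\omega_2)=\sup_{u\in K(\omega_1,\omega_2)}\|u\|$.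
   Context: $\ell^2$ is the Hilbert space of real sequences $u=(u_i)_{i\in\mathbb{Z}}$ with $\|u\|^2=\sum_i|u_i|^2<\infty$. Parametric dynamical systems: $\Omega_1$ is a nonempty set and $\{\theta_{1,t}\}_{t\in\mathbb{R}}$ a family of maps $\Omega_1\to\Omega_1$ with $\theta_{1,0}=\mathrm{id}$, $\theta_{1,s+t}=\theta_{1,t}\theta_{1,s}$. $(\Omega_2,\mathcal{F}_2,P)$ is a probability space and $\theta_2:\mathbb{R}\times\Omega_2\to\Omega_2$ is $(\mathcal{B}(\mathbb{R})\times\mathcal{F}_2,\mathcal{F}_2)$-measurable; writing $\theta_{2,t}=\theta_2(t,\cdot)$, one has $\theta_{2,0}=\mathrm{id}$, $\theta_{2,s+t}=\theta_{2,t}\theta_{2,s}$ and $\theta_{2,t}$ preserves $P$. Continuous cocycle on $X$ (a complete separable metric space, here $X=\ell^2$): a map $\Phi:\mathbb{R}^+\times\Omega_1\times\Omega_2\times X\to X$ such that for all $\omega_1,\omega_2$ and $t,\tau\in\mathbb{R}^+$: $\Phi(\cdot,\omega_1,\cdot,\cdot)$ is $(\mathcal{B}(\mathbb{R}^+)\times\mathcal{F}_2\times\mathcal{B}(X),\mathcal{B}(X))$-measurable; $\Phi(0,\omega_1,\omega_2,\cdot)=\mathrm{id}$; $\Phi(t+\tau,\omega_1,\omega_2,\cdot)=\Phi(t,\theta_{1,\tau}\omega_1,\theta_{2,\tau}\omega_2,\cdot)\circ\Phi(\tau,\omega_1,\omega_2,\cdot)$; $\Phi(t,\omega_1,\omega_2,\cdot)$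 is continuous. $\mathcal{D}(\ell^2)$ is the collection of all families $D=\{D(\omega_1,\omega_2):\omega_1\in\Omega_1,\omega_2\in\Omega_2\}$ of bounded nonempty subsets of $\ell^2$ such that for every $\gamma>0$, $\lim_{s\to+\infty}e^{-\gamma s}\|D(\theta_{1,-s}\omega_1,\theta_{2,-s}\omega_2)\|^2=0$, where $\|D\|=\sup_{u\in D}\|u\|$ for a bounded set $D$. A family $K=\{K(\omega_1,\omega_2)\}$ of closed nonempty sets is measurable w.r.t. a $\sigma$-algebra $\mathcal{G}$ on $\Omega_2$ if $\omega_2\mapsto d(x,K(\omega_1,\omega_2))$ is $(\mathcal{G},\mathcal{B}(\mathbb{R}))$-measurable for every $x\in X$, $\omega_1\in\Omega_1$. A closed measurable $\mathcal{D}(\ell^2)$-pullback absorbing set is a family $K\in\mathcal{D}(\ell^2)$ of closed nonempty sets, measurable w.r.t. the $P$-completion of $\mathcal{F}_2$, such that for all $\omega_1\in\Omega_1$, $\omega_2\in\Omega_2$ and every $B\in\mathcal{D}(\ell^2)$ there is $T=T(B,\omega_1,\omega_2)>0$ with $\Phi(t,\theta_{1,-t}\omega_1,\theta_{2,-t}\omega_2,B(\theta_{1,-t}\omega_1,\theta_{2,-t}\omega_2))\subseteq K(\omega_1,\omega_2)$ for all $t\ge T$. A $\mathcal{D}(\ell^2)$-pullback attractor for $\Phi$ is a family $\mathcal{A}\in\mathcal{D}(\ell^2)$ such that: $\mathcal{A}$ is measurable w.r.t. the $P$-completion of $\mathcal{F}_2$ and each $\mathcal{A}(\omega_1,\omega_2)$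 is compact; $\Phi(t,\omega_1,\omega_2,\mathcal{A}(\omega_1,\omega_2))=\mathcal{A}(\theta_{1,t}\omega_1,\theta_{2,t}\omega_2)$ for all $t\ge0$; and for every $B\in\mathcal{D}(\ell^2)$ and all $\omega_1,\omega_2$, $\lim_{t\to\infty}d(\Phi(t,\theta_{1,-t}\omega_1,\theta_{2,-t}\omega_2,B(\theta_{1,-t}\omega_1,\theta_{2,-t}\omega_2)),\mathcal{A}(\omega_1,\omega_2))=0$, where $d(Y,Z)=\sup_{y\in Y}\inf_{z\in Z}d(y,z)$ (Hausdorff semi-distance). Kolmogorov $\varepsilon$-entropy of a subset $Y$ of a Banach space $X$: $\mathbb{K}_\varepsilon(Y)=\ln n_\varepsilon(Y)\in[0,+\infty]$, where $n_\varepsilon(Y)$ is the minimal number $n\ge1$ of open balls of radius $\varepsilon$ in $X$ (arbitrary centres) covering $Y$.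
   Formalization: In (ii) the bound is stated with I_0 = I_0(ε/2, ω_1, ω_2, K) instead of I_0(ε, ω_1, ω_2, K), since the printed bound fails; and "for a.e. ω_1, ω_2" in (a) and (b) is replaced by "for all ω_1, ω_2". *)

theory Defs
  imports "HOL-Probability.Probability"
begin

section \<open>The Hilbert space of square-summable real sequences indexed by the integers\<close>

typedef ell2 = "{u :: int \<Rightarrow> real. (\<lambda>i. (u i)\<^sup>2) summable_on UNIV}"
  morphisms coord Abs_ell2
  by (rule exI[of _ "\<lambda>_. 0"]) simp

setup_lifting type_definition_ell2

lemma summable_coord_sq: "(\<lambda>i. (coord u i)\<^sup>2) summable_on UNIV"
  using coord[of u] by simp

lemma sq_summable_mult:
  fixes u v :: "int \<Rightarrow> real"
  assumes "(\<lambda>i. (u i)\<^sup>2) summable_on UNIV" "(\<lambda>i. (v i)\<^sup>2) summable_on UNIV"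
  shows "(\<lambda>i. u i * v i) summable_on UNIV"
proof -
  have "(\<lambda>i. (u i)\<^sup>2 + (v i)\<^sup>2) summable_on UNIV"
    using assms by (rule summable_on_add)
  moreover have "\<bar>u i * v i\<bar> \<le> (u i)\<^sup>2 + (v i)\<^sup>2" for i
  proof -
    have "2 * (\<bar>u i\<bar> * \<bar>v i\<bar>) \<le> (u i)\<^sup>2 + (v i)\<^sup>2"
      using sum_squares_bound[of "\<bar>u i\<bar>" "\<bar>v i\<bar>"] by (simp add: mult.assoc)
    moreover have "0 \<le> \<bar>u i\<bar> * \<bar>v i\<bar>" by simp
    ultimately show ?thesis unfolding abs_mult by linarith
  qed
  ultimately have "(\<lambda>i. \<bar>u i * v i\<bar>) summable_on UNIV"
    by (rule summable_on_comparison_test) auto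
  then show ?thesis
    using summable_on_iff_abs_summable_on_real[of "\<lambda>i. u i * v i" UNIV] by simp
qed

lemma sq_summable_add:
  fixes u v :: "int \<Rightarrow> real"
  assumes "(\<lambda>i. (u i)\<^sup>2) summable_on UNIV" "(\<lambda>i. (v i)\<^sup>2) summable_on UNIV"
  shows "(\<lambda>i. (u i + v i)\<^sup>2) summable_on UNIV"
proof -
  have "(\<lambda>i. (u i)\<^sup>2 + (v i)\<^sup>2 + 2 * (u i * v i)) summable_on UNIV"
    by (intro summable_on_add summable_on_cmult_right sq_summable_mult assms)
  then show ?thesis by (simp add: power2_sum mult.assoc)
qed

lemma sq_summable_scale:
  fixes u :: "int \<Rightarrow> real"
  assumes "(\<lambda>i. (u i)\<^sup>2) summable_on UNIV"
  shows "(\<lambda>i. (c * u i)\<^sup>2) summable_on UNIV"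
  using summable_on_cmult_right[OF assms, of "c\<^sup>2"] by (simp add: power_mult_distrib)

instantiation ell2 :: real_inner
begin

lift_definition zero_ell2 :: ell2 is "\<lambda>_. 0" by simp

lift_definition plus_ell2 :: "ell2 \<Rightarrow> ell2 \<Rightarrow> ell2" is "\<lambda>u v i. u i + v i"
  by (rule sq_summable_add)

lift_definition uminus_ell2 :: "ell2 \<Rightarrow> ell2" is "\<lambda>u i. - u i" by simp

lift_definition minus_ell2 :: "ell2 \<Rightarrow> ell2 \<Rightarrow> ell2" is "\<lambda>u v i. u i - v i"
  using sq_summable_add[of _ "\<lambda>i. - _ i"] by simp

lift_definition scaleR_ell2 :: "real \<Rightarrow> ell2 \<Rightarrow> ell2" is "\<lambda>c u i. c * u i"
  by (rule sq_summable_scale)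

definition inner_ell2 :: "ell2 \<Rightarrow> ell2 \<Rightarrow> real" where
  "inner_ell2 u v = (\<Sum>\<^sub>\<infinity>i. coord u i * coord v i)"

definition norm_ell2 :: "ell2 \<Rightarrow> real" where
  "norm_ell2 u = sqrt (\<Sum>\<^sub>\<infinity>i. (coord u i)\<^sup>2)"

definition dist_ell2 :: "ell2 \<Rightarrow> ell2 \<Rightarrow> real" where
  "dist_ell2 u v = norm (u - v)"

definition sgn_ell2 :: "ell2 \<Rightarrow> ell2" where
  "sgn_ell2 u = inverse (norm u) *\<^sub>R u"

definition uniformity_ell2 :: "(ell2 \<times> ell2) filter" where
  "uniformity_ell2 = (INF e\<in>{0<..}. principal {(u, v). dist u v < e})"

definition open_ell2 :: "ell2 set \<Rightarrow> bool" where
  "open_ell2 U \<longleftrightarrow> (\<forall>u\<in>U. \<forall>\<^sub>F (u', v) in uniformity. u' = u \<longrightarrow> v \<in> U)"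

instance
proof
  fix u v w :: ell2 and a b :: real
  show "u + v + w = u + (v + w)" by transfer (simp add: add.assoc)
  show "u + v = v + u" by transfer (simp add: add.commute)
  show "0 + u = u" by transfer simp
  show "- u + u = 0" by transfer simp
  show "u - v = u + - v" by transfer simp
  show "a *\<^sub>R (u + v) = a *\<^sub>R u + a *\<^sub>R v" by transfer (simp add: distrib_left)
  show "(a + b) *\<^sub>R u = a *\<^sub>R u + b *\<^sub>R u" by transfer (simp add: distrib_right)
  show "a *\<^sub>R b *\<^sub>R u = (a * b) *\<^sub>R u" by transfer (simp add: mult.assoc)
  show "1 *\<^sub>R u = u" by transfer simp
  show "dist u v = norm (u - v)" by (rule dist_ell2_def)
  show "sgn u = inverse (norm u) *\<^sub>R u" by (rule sgn_ell2_def)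
  show "uniformity = (INF e\<in>{0<..}. principal {(u :: ell2, v). dist u v < e})"
    by (rule uniformity_ell2_def)
  show "open U \<longleftrightarrow> (\<forall>u\<in>U. \<forall>\<^sub>F (u', v) in uniformity. u' = u \<longrightarrow> v \<in> U)"
    for U :: "ell2 set" by (rule open_ell2_def)
  show "inner u v = inner v u" by (simp add: inner_ell2_def mult.commute)
  show "inner (u + v) w = inner u w + inner v w"
    by (simp add: inner_ell2_def plus_ell2.rep_eq distrib_right infsum_add
        sq_summable_mult summable_coord_sq)
  show "inner (a *\<^sub>R u) v = a * inner u v"
    by (simp add: inner_ell2_def scaleR_ell2.rep_eq mult.assoc infsum_cmult_right')
  show "0 \<le> inner u u" by (simp add: inner_ell2_def infsum_nonneg)
  show "inner u u = 0 \<longleftrightarrow> u = 0"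
  proof
    assume *: "inner u u = 0"
    have "coord u i = 0" for i
    proof -
      have "(\<Sum>j\<in>{i}. (coord u j)\<^sup>2) \<le> (\<Sum>\<^sub>\<infinity>j. (coord u j)\<^sup>2)"
        by (rule finite_sum_le_infsum) (auto simp: summable_coord_sq)
      also have "\<dots> = 0" using * by (simp add: inner_ell2_def power2_eq_square)
      finally show ?thesis by simp
    qed
    then show "u = 0" by transfer auto
  qed (simp add: inner_ell2_def zero_ell2.rep_eq)
  show "norm u = sqrt (inner u u)"
    by (simp add: norm_ell2_def inner_ell2_def power2_eq_square)
qed

end

lemma coord_diff: "coord (u - v) i = coord u i - coord v i"
  by (simp add: minus_ell2.rep_eq)

lemma norm_ell2_le_iff:
  assumes "0 \<le> e"
  shows "norm u \<le> e \<longleftrightarrow> (\<forall>F. finite F \<longrightarrow> (\<Sum>i\<in>F. (coord u i)\<^sup>2) \<le> e\<^sup>2)"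
proof
  assume *: "norm u \<le> e"
  show "\<forall>F. finite F \<longrightarrow> (\<Sum>i\<in>F. (coord u i)\<^sup>2) \<le> e\<^sup>2"
  proof (intro allI impI)
    fix F :: "int set" assume "finite F"
    then have "(\<Sum>i\<in>F. (coord u i)\<^sup>2) \<le> (\<Sum>\<^sub>\<infinity>i. (coord u i)\<^sup>2)"
      by (intro finite_sum_le_infsum) (auto simp: summable_coord_sq)
    also have "\<dots> = (norm u)\<^sup>2"
      by (simp add: norm_ell2_def infsum_nonneg)
    also have "\<dots> \<le> e\<^sup>2" using * by (intro power_mono) auto
    finally show "(\<Sum>i\<in>F. (coord u i)\<^sup>2) \<le> e\<^sup>2" .
  qed
next
  assume "\<forall>F. finite F \<longrightarrow> (\<Sum>i\<in>F. (coord u i)\<^sup>2) \<le> e\<^sup>2"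
  then have "(\<Sum>\<^sub>\<infinity>i. (coord u i)\<^sup>2) \<le> e\<^sup>2"
    by (intro infsum_le_finite_sums) (auto simp: summable_coord_sq)
  then show "norm u \<le> e"
    using assms by (simp add: norm_ell2_def real_le_lsqrt infsum_nonneg)
qed

lemma abs_coord_le_norm: "\<bar>coord u i\<bar> \<le> norm u"
proof (rule power2_le_imp_le)
  show "\<bar>coord u i\<bar>\<^sup>2 \<le> (norm u)\<^sup>2"
    using norm_ell2_le_iff[of "norm u" u, THEN iffD1, rule_format, of "{i}"] by simp
qed simp

instance ell2 :: complete_space
proof
  fix X :: "nat \<Rightarrow> ell2"
  assume X: "Cauchy X"
  have "\<exists>l. (\<lambda>n. coord (X n) i) \<longlonglongrightarrow> l" for i
  proof -
    have "Cauchy (\<lambda>n. coord (X n) i)"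
    proof (rule metric_CauchyI)
      fix e :: real assume "0 < e"
      then obtain N where "\<forall>m\<ge>N. \<forall>n\<ge>N. dist (X m) (X n) < e"
        using X unfolding Cauchy_def by blast
      then show "\<exists>M. \<forall>m\<ge>M. \<forall>n\<ge>M. dist (coord (X m) i) (coord (X n) i) < e"
        by (metis abs_coord_le_norm coord_diff dist_norm dist_real_def order_le_less_trans)
    qed
    then show ?thesis by (simp add: Cauchy_convergent convergent_def[symmetric])
  qed
  then obtain l where l: "\<And>i. (\<lambda>n. coord (X n) i) \<longlonglongrightarrow> l i" by metis
  have fin: "(\<Sum>i\<in>F. (coord (X n) i - l i)\<^sup>2) \<le> e\<^sup>2"
    if "finite F" "0 < e" "\<forall>m\<ge>N. \<forall>n\<ge>N. dist (X m) (X n) < e" "n \<ge> N" for F e N n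
  proof (rule tendsto_upperbound)
    show "(\<lambda>m. \<Sum>i\<in>F. (coord (X n) i - coord (X m) i)\<^sup>2)
        \<longlonglongrightarrow> (\<Sum>i\<in>F. (coord (X n) i - l i)\<^sup>2)"
      by (intro tendsto_intros l)
    show "\<forall>\<^sub>F m in sequentially. (\<Sum>i\<in>F. (coord (X n) i - coord (X m) i)\<^sup>2) \<le> e\<^sup>2"
    proof (rule eventually_sequentiallyI[of N])
      fix m assume "N \<le> m"
      then have "norm (X n - X m) \<le> e"
        using that by (simp add: dist_norm less_imp_le)
      then show "(\<Sum>i\<in>F. (coord (X n) i - coord (X m) i)\<^sup>2) \<le> e\<^sup>2"
        using that norm_ell2_le_iff[of e "X n - X m"] by (simp add: coord_diff)
    qed
  qed simp
  have sq: "(\<lambda>i. (l i)\<^sup>2) summable_on UNIV"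
  proof -
    obtain N where N: "\<forall>m\<ge>N. \<forall>n\<ge>N. dist (X m) (X n) < 1"
      using X unfolding Cauchy_def by (meson zero_less_one)
    have "(\<lambda>i. (coord (X N) i - l i)\<^sup>2) summable_on UNIV"
      by (rule nonneg_bdd_above_summable_on)
        (use fin[OF _ _ N, of _ N] in \<open>auto intro!: bdd_aboveI2[of _ _ 1]\<close>)
    from sq_summable_add[OF summable_coord_sq[of "X N"] sq_summable_scale[OF this, of "-1"]]
    show ?thesis by simp
  qed
  have "X \<longlonglongrightarrow> Abs_ell2 l"
  proof (rule metric_LIMSEQ_I)
    fix r :: real assume "0 < r"
    then obtain N where N: "\<forall>m\<ge>N. \<forall>n\<ge>N. dist (X m) (X n) < r / 2"
      using X unfolding Cauchy_def by (meson half_gt_zero)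
    have "dist (X n) (Abs_ell2 l) < r" if "n \<ge> N" for n
    proof -
      have "norm (X n - Abs_ell2 l) \<le> r / 2"
        using \<open>0 < r\<close> fin[OF _ _ N that] sq
        by (subst norm_ell2_le_iff) (auto simp: coord_diff Abs_ell2_inverse)
      then show ?thesis using \<open>0 < r\<close> by (simp add: dist_norm)
    qed
    then show "\<exists>N. \<forall>n\<ge>N. dist (X n) (Abs_ell2 l) < r" by blast
  qed
  then show "convergent X" by (auto simp: convergent_def)
qed

instance ell2 :: banach ..


section \<open>Parametric dynamical systems and cocycles\<close>

text \<open>The nonempty set \<open>\<Omega>\<^sub>1\<close> is the type \<open>'w1\<close>; the sample space \<open>\<Omega>\<^sub>2\<close> is \<^term>\<open>space M\<close>, so
  every quantifier over \<open>\<omega>\<^sub>2\<close> below is bounded by \<^term>\<open>space M\<close> and a family of sets is only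
  meaningful there.\<close>

definition parametric_flow :: "(real \<Rightarrow> 'w1 \<Rightarrow> 'w1) \<Rightarrow> bool" where
  "parametric_flow \<theta>1 \<longleftrightarrow> \<theta>1 0 = id \<and> (\<forall>s t. \<theta>1 (s + t) = \<theta>1 t \<circ> \<theta>1 s)"

definition metric_dynamical_system :: "'w2 measure \<Rightarrow> (real \<Rightarrow> 'w2 \<Rightarrow> 'w2) \<Rightarrow> bool" where
  "metric_dynamical_system M \<theta>2 \<longleftrightarrow>
     prob_space M \<and>
     (\<lambda>(t, \<omega>2). \<theta>2 t \<omega>2) \<in> borel \<Otimes>\<^sub>M M \<rightarrow>\<^sub>M M \<and>
     (\<forall>\<omega>2\<in>space M. \<theta>2 0 \<omega>2 = \<omega>2) \<and>
     (\<forall>s t. \<forall>\<omega>2\<in>space M. \<theta>2 (s + t) \<omega>2 = \<theta>2 t (\<theta>2 s \<omega>2)) \<and>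
     (\<forall>t. distr M M (\<theta>2 t) = M)"

text \<open>Time is a real number; a cocycle is only constrained at times \<open>t \<ge> 0\<close>.\<close>

definition continuous_cocycle ::
  "(real \<Rightarrow> 'w1 \<Rightarrow> 'w1) \<Rightarrow> 'w2 measure \<Rightarrow> (real \<Rightarrow> 'w2 \<Rightarrow> 'w2) \<Rightarrow>
   (real \<Rightarrow> 'w1 \<Rightarrow> 'w2 \<Rightarrow> 'x \<Rightarrow> 'x::metric_space) \<Rightarrow> bool" where
  "continuous_cocycle \<theta>1 M \<theta>2 \<Phi> \<longleftrightarrow>
     (\<forall>\<omega>1. (\<lambda>(t, \<omega>2, u). \<Phi> t \<omega>1 \<omega>2 u)
            \<in> restrict_space borel {0..} \<Otimes>\<^sub>M (M \<Otimes>\<^sub>M borel) \<rightarrow>\<^sub>M borel) \<and>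
     (\<forall>\<omega>1. \<forall>\<omega>2\<in>space M.
        \<Phi> 0 \<omega>1 \<omega>2 = id \<and>
        (\<forall>t\<ge>0. \<forall>\<tau>\<ge>0. \<Phi> (t + \<tau>) \<omega>1 \<omega>2 = \<Phi> t (\<theta>1 \<tau> \<omega>1) (\<theta>2 \<tau> \<omega>2) \<circ> \<Phi> \<tau> \<omega>1 \<omega>2) \<and>
        (\<forall>t\<ge>0. continuous_on UNIV (\<Phi> t \<omega>1 \<omega>2)))"


section \<open>Tempered families, absorbing sets and pullback attractors\<close>

type_synonym ('w1, 'w2) family = "'w1 \<Rightarrow> 'w2 \<Rightarrow> ell2 set"

definition set_norm :: "'x::real_normed_vector set \<Rightarrow> real" where
  "set_norm D = (SUP u\<in>D. norm u)"

definition tempered ::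
  "(real \<Rightarrow> 'w1 \<Rightarrow> 'w1) \<Rightarrow> 'w2 measure \<Rightarrow> (real \<Rightarrow> 'w2 \<Rightarrow> 'w2) \<Rightarrow> ('w1, 'w2) family \<Rightarrow> bool" where
  "tempered \<theta>1 M \<theta>2 D \<longleftrightarrow>
     (\<forall>\<omega>1. \<forall>\<omega>2\<in>space M.
        D \<omega>1 \<omega>2 \<noteq> {} \<and> bounded (D \<omega>1 \<omega>2) \<and>
        (\<forall>\<gamma>>0. ((\<lambda>s. exp (- \<gamma> * s) * (set_norm (D (\<theta>1 (- s) \<omega>1) (\<theta>2 (- s) \<omega>2)))\<^sup>2) \<longlongrightarrow> 0)
                at_top))"

text \<open>Measurability with respect to the \<open>P\<close>-completion of the \<open>\<sigma>\<close>-algebra of \<open>M\<close>.\<close>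

definition completion_measurable :: "'w2 measure \<Rightarrow> ('w1, 'w2) family \<Rightarrow> bool" where
  "completion_measurable M K \<longleftrightarrow>
     (\<forall>x \<omega>1. (\<lambda>\<omega>2. infdist x (K \<omega>1 \<omega>2)) \<in> borel_measurable (completion M))"

definition pullback_image ::
  "(real \<Rightarrow> 'w1 \<Rightarrow> 'w1) \<Rightarrow> (real \<Rightarrow> 'w2 \<Rightarrow> 'w2) \<Rightarrow> (real \<Rightarrow> 'w1 \<Rightarrow> 'w2 \<Rightarrow> ell2 \<Rightarrow> ell2) \<Rightarrow>
   ('w1, 'w2) family \<Rightarrow> 'w1 \<Rightarrow> 'w2 \<Rightarrow> real \<Rightarrow> ell2 set" where
  "pullback_image \<theta>1 \<theta>2 \<Phi> B \<omega>1 \<omega>2 t =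
     \<Phi> t (\<theta>1 (- t) \<omega>1) (\<theta>2 (- t) \<omega>2) ` B (\<theta>1 (- t) \<omega>1) (\<theta>2 (- t) \<omega>2)"

definition absorbs_from ::
  "(real \<Rightarrow> 'w1 \<Rightarrow> 'w1) \<Rightarrow> (real \<Rightarrow> 'w2 \<Rightarrow> 'w2) \<Rightarrow> (real \<Rightarrow> 'w1 \<Rightarrow> 'w2 \<Rightarrow> ell2 \<Rightarrow> ell2) \<Rightarrow>
   ('w1, 'w2) family \<Rightarrow> ('w1, 'w2) family \<Rightarrow> 'w1 \<Rightarrow> 'w2 \<Rightarrow> real \<Rightarrow> bool" where
  "absorbs_from \<theta>1 \<theta>2 \<Phi> K B \<omega>1 \<omega>2 T \<longleftrightarrow>
     0 < T \<and> (\<forall>t\<ge>T. pullback_image \<theta>1 \<theta>2 \<Phi> B \<omega>1 \<omega>2 t \<subseteq> K \<omega>1 \<omega>2)"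

definition closed_measurable_absorbing ::
  "(real \<Rightarrow> 'w1 \<Rightarrow> 'w1) \<Rightarrow> 'w2 measure \<Rightarrow> (real \<Rightarrow> 'w2 \<Rightarrow> 'w2) \<Rightarrow>
   (real \<Rightarrow> 'w1 \<Rightarrow> 'w2 \<Rightarrow> ell2 \<Rightarrow> ell2) \<Rightarrow> ('w1, 'w2) family \<Rightarrow> bool" where
  "closed_measurable_absorbing \<theta>1 M \<theta>2 \<Phi> K \<longleftrightarrow>
     tempered \<theta>1 M \<theta>2 K \<and>
     (\<forall>\<omega>1. \<forall>\<omega>2\<in>space M. closed (K \<omega>1 \<omega>2)) \<and>
     completion_measurable M K \<and>
     (\<forall>\<omega>1. \<forall>\<omega>2\<in>space M. \<forall>B. tempered \<theta>1 M \<theta>2 B \<longrightarrow>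
        (\<exists>T. absorbs_from \<theta>1 \<theta>2 \<Phi> K B \<omega>1 \<omega>2 T))"

text \<open>Suprema over sets that need not be bounded a priori are taken in \<^typ>\<open>ennreal\<close>, so that an
  unbounded set has the value \<open>\<infinity>\<close>.\<close>

definition hausdorff_semidist :: "'x::metric_space set \<Rightarrow> 'x set \<Rightarrow> ennreal" where
  "hausdorff_semidist Y Z = (SUP y\<in>Y. ennreal (infdist y Z))"

definition pullback_attractor ::
  "(real \<Rightarrow> 'w1 \<Rightarrow> 'w1) \<Rightarrow> 'w2 measure \<Rightarrow> (real \<Rightarrow> 'w2 \<Rightarrow> 'w2) \<Rightarrow>
   (real \<Rightarrow> 'w1 \<Rightarrow> 'w2 \<Rightarrow> ell2 \<Rightarrow> ell2) \<Rightarrow> ('w1, 'w2) family \<Rightarrow> bool" where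
  "pullback_attractor \<theta>1 M \<theta>2 \<Phi> A \<longleftrightarrow>
     tempered \<theta>1 M \<theta>2 A \<and>
     completion_measurable M A \<and>
     (\<forall>\<omega>1. \<forall>\<omega>2\<in>space M. compact (A \<omega>1 \<omega>2)) \<and>
     (\<forall>\<omega>1. \<forall>\<omega>2\<in>space M. \<forall>t\<ge>0. \<Phi> t \<omega>1 \<omega>2 ` A \<omega>1 \<omega>2 = A (\<theta>1 t \<omega>1) (\<theta>2 t \<omega>2)) \<and>
     (\<forall>B. tempered \<theta>1 M \<theta>2 B \<longrightarrow>
        (\<forall>\<omega>1. \<forall>\<omega>2\<in>space M.
          ((\<lambda>t. hausdorff_semidist (pullback_image \<theta>1 \<theta>2 \<Phi> B \<omega>1 \<omega>2 t) (A \<omega>1 \<omega>2)) \<longlongrightarrow> 0) at_top))"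


section \<open>Asymptotic nullness and Kolmogorov entropy\<close>

definition null_from ::
  "(real \<Rightarrow> 'w1 \<Rightarrow> 'w1) \<Rightarrow> (real \<Rightarrow> 'w2 \<Rightarrow> 'w2) \<Rightarrow> (real \<Rightarrow> 'w1 \<Rightarrow> 'w2 \<Rightarrow> ell2 \<Rightarrow> ell2) \<Rightarrow>
   ('w1, 'w2) family \<Rightarrow> 'w1 \<Rightarrow> 'w2 \<Rightarrow> real \<Rightarrow> real \<Rightarrow> nat \<Rightarrow> bool" where
  "null_from \<theta>1 \<theta>2 \<Phi> K \<omega>1 \<omega>2 \<epsilon> T I \<longleftrightarrow>
     0 < T \<and>
     (\<forall>t\<ge>T. (SUP u\<in>K (\<theta>1 (- t) \<omega>1) (\<theta>2 (- t) \<omega>2).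
               ennreal (\<Sum>\<^sub>\<infinity>i\<in>{i. \<bar>i\<bar> > int I}.
                          \<bar>coord (\<Phi> t (\<theta>1 (- t) \<omega>1) (\<theta>2 (- t) \<omega>2) u) i\<bar>\<^sup>2))
             \<le> ennreal (\<epsilon>\<^sup>2))"

definition asymptotically_null ::
  "(real \<Rightarrow> 'w1 \<Rightarrow> 'w1) \<Rightarrow> 'w2 measure \<Rightarrow> (real \<Rightarrow> 'w2 \<Rightarrow> 'w2) \<Rightarrow>
   (real \<Rightarrow> 'w1 \<Rightarrow> 'w2 \<Rightarrow> ell2 \<Rightarrow> ell2) \<Rightarrow> ('w1, 'w2) family \<Rightarrow> bool" where
  "asymptotically_null \<theta>1 M \<theta>2 \<Phi> K \<longleftrightarrow>
     (\<forall>\<omega>1. \<forall>\<omega>2\<in>space M. \<forall>\<epsilon>>0. \<exists>T I. null_from \<theta>1 \<theta>2 \<Phi> K \<omega>1 \<omega>2 \<epsilon> T I)"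

definition covering_number :: "real \<Rightarrow> 'x::metric_space set \<Rightarrow> enat" where
  "covering_number \<epsilon> Y =
     Inf {enat n | n. n \<ge> 1 \<and> (\<exists>C. finite C \<and> card C = n \<and> Y \<subseteq> (\<Union>c\<in>C. ball c \<epsilon>))}"

definition kolmogorov_entropy :: "real \<Rightarrow> 'x::metric_space set \<Rightarrow> ereal" where
  "kolmogorov_entropy \<epsilon> Y =
     (case covering_number \<epsilon> Y of enat n \<Rightarrow> ereal (ln (real n)) | \<infinity> \<Rightarrow> \<infinity>)"

end

theory Submission
  imports Defs
begin

text \<open>The attractor is the omega-limit set of the pullback images of \<open>K\<close>. These images are
  eventually bounded (they enter \<open>K\<close>) and have uniformly small tails, so a grid on the finitely many
  remaining coordinates gives finite \<open>\<epsilon>\<close>-covers. This yields asymptotic compactness and, because the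
  attractor inherits the bound and the tail estimate, also the entropy bound.

  For measurability, invariance and \<open>A \<subseteq> K\<close> put \<open>A\<close> inside every pullback image of \<open>K\<close>, and those
  images converge to \<open>A\<close>; hence the distance to \<open>A\<close> is the limit, along integer times, of the
  distances to the images. Only fixed times occur, so no projection theorem is needed.\<close>

section \<open>Finite covers in the sequence space\<close>

text \<open>Cut \<open>[-r, r]\<close> into \<open>N\<close> intervals of length
  \<open>2 * r / N\<close>. The numbers \<open>r * (2 * k + 1) / N - r\<close> are their midpoints,
  and no point is further than half a length from the midpoint of its interval.\<close>

lemma grid_point:
  fixes x r :: real
  assumes "\<bar>x\<bar> \<le> r" "0 < N"
  shows "\<exists>k<N. \<bar>x - (r * (2 * real k + 1) / real N - r)\<bar> \<le> r / real N"
proof (cases "r = 0")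
  case True
  then show ?thesis using assms by auto
next
  case False
  then have r: "0 < r" using assms by linarith
  define y where "y = (x + r) * real N / (2 * r)"
  have y0: "0 \<le> y" using assms r by (auto simp: y_def)
  have yN: "y \<le> real N"
  proof -
    have "(x + r) * real N \<le> (2 * r) * real N"
      using assms by (intro mult_right_mono) auto
    then show ?thesis using r by (simp add: y_def field_simps)
  qed
  have x: "x = 2 * r * y / real N - r"
    using r assms by (simp add: y_def field_simps)
  \<comment> \<open>Here \<open>y\<close> is the position of \<open>x\<close> in units of one
    interval. The right endpoint has \<open>y = N\<close>, whose floor would be an index out of
    range, so it goes into the last interval.\<close>
  define k where "k = (if y = real N then N - 1 else nat \<lfloor>y\<rfloor>)"
  have k: "k < N" "real k \<le> y" "y \<le> real k + 1"
  proof -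
    have "k < N \<and> real k \<le> y \<and> y \<le> real k + 1"
    proof (cases "y = real N")
      case True
      then show ?thesis using assms by (auto simp: k_def)
    next
      case False
      then have "y < real N" using yN by simp
      then show ?thesis using False y0 by (auto simp: k_def nat_less_iff floor_less_iff)
    qed
    then show "k < N" "real k \<le> y" "y \<le> real k + 1" by auto
  qed
  have "x - (r * (2 * real k + 1) / real N - r) = r / real N * (2 * (y - real k) - 1)"
    by (subst x) (simp add: field_simps diff_divide_distrib)
  also have "\<bar>\<dots>\<bar> = r / real N * \<bar>2 * (y - real k) - 1\<bar>"
    using r by (simp add: abs_mult)
  also have "\<dots> \<le> r / real N * 1"
    using k r by (intro mult_left_mono) auto
  finally show ?thesis using k(1) by auto
qed

section \<open>Splitting the norm into head and tail; covers by a coordinate grid\<close>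

lemma norm_ell2_sq: "(norm u)\<^sup>2 = (\<Sum>\<^sub>\<infinity>i. (coord u i)\<^sup>2)"
  by (simp add: norm_ell2_def infsum_nonneg)

lemma summable_coord_sq_on: "(\<lambda>i. (coord u i)\<^sup>2) summable_on S"
  using summable_on_subset_banach[OF summable_coord_sq] by blast

lemma norm_ell2_sq_split:
  "(norm u)\<^sup>2 = (\<Sum>i\<in>{- int n..int n}. (coord u i)\<^sup>2) + (\<Sum>\<^sub>\<infinity>i\<in>{i. \<bar>i\<bar> > int n}. (coord u i)\<^sup>2)"
proof -
  have "(\<Sum>\<^sub>\<infinity>i\<in>{- int n..int n} \<union> {i. \<bar>i\<bar> > int n}. (coord u i)\<^sup>2) =
      (\<Sum>\<^sub>\<infinity>i\<in>{- int n..int n}. (coord u i)\<^sup>2) + (\<Sum>\<^sub>\<infinity>i\<in>{i. \<bar>i\<bar> > int n}. (coord u i)\<^sup>2)"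
    by (intro infsum_Un_disjoint summable_coord_sq_on) auto
  moreover have "{- int n..int n} \<union> {i. \<bar>i\<bar> > int n} = UNIV" by auto
  ultimately show ?thesis by (simp add: norm_ell2_sq)
qed

text \<open>The centres take grid values on the \<open>2 * n + 1\<close> coordinates with
  \<open>\<bar>i\<bar> \<le> n\<close> and vanish elsewhere. Dropping the tail and rounding the head
  each cost at most \<open>(\<epsilon> / 2)\<^sup>2\<close> in the squared distance. The number of
  centres stays explicit because the entropy bound is read off from it.\<close>

lemma ell2_finite_cover:
  assumes \<epsilon>: "0 < \<epsilon>" and r: "0 \<le> r" and bd: "\<And>u. u \<in> S \<Longrightarrow> norm u \<le> r"
    and tail: "\<And>u. u \<in> S \<Longrightarrow> (\<Sum>\<^sub>\<infinity>i\<in>{i. \<bar>i\<bar> > int n}. (coord u i)\<^sup>2) \<le> (\<epsilon> / 2)\<^sup>2"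
  shows "\<exists>C. finite C \<and>
    card C \<le> nat (\<lfloor>2 * r * sqrt (real (2 * n + 1)) / \<epsilon>\<rfloor> + 1) ^ (2 * n + 1) \<and>
    S \<subseteq> (\<Union>c\<in>C. ball c \<epsilon>)"
proof -
  define N where "N = nat (\<lfloor>2 * r * sqrt (real (2 * n + 1)) / \<epsilon>\<rfloor> + 1)"
  define J where "J = {- int n..int n}"
  define g where "g k = r * (2 * real k + 1) / real N - r" for k :: nat
  \<comment> \<open>Being zero outside \<open>J\<close> makes \<open>c p\<close> square-summable and
    leaves \<open>u - c p\<close> with the same tail as \<open>u\<close>.\<close>
  define c where "c p = Abs_ell2 (\<lambda>i. if i \<in> J then g (p i) else 0)" for p :: "int \<Rightarrow> nat"
  define C where "C = c ` (J \<rightarrow>\<^sub>E {..<N})"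
  have J: "finite J" "card J = 2 * n + 1" by (auto simp: J_def)
  have fl: "0 \<le> \<lfloor>2 * r * sqrt (real (2 * n + 1)) / \<epsilon>\<rfloor>" using r \<epsilon> by simp
  then have N0: "0 < N" by (simp add: N_def)
  have coord_c: "coord (c p) i = (if i \<in> J then g (p i) else 0)" for p i
  proof -
    have "(\<lambda>i. (if i \<in> J then g (p i) else 0)\<^sup>2) summable_on UNIV"
      by (rule finite_nonzero_values_imp_summable_on)
        (use J in \<open>auto intro: rev_finite_subset[of J]\<close>)
    then show ?thesis by (simp add: c_def Abs_ell2_inverse)
  qed
  \<comment> \<open>Rounding moves each of the \<open>2 * n + 1\<close> coordinates by at most
    \<open>r / N\<close>; the size of \<open>N\<close> is chosen to keep the sum of the squares
    below \<open>(\<epsilon> / 2)\<^sup>2\<close>. The \<open>+ 1\<close> in \<open>N\<close> also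
    keeps it positive when the floor is zero.\<close>
  have Nbig: "real (2 * n + 1) * (r / real N)\<^sup>2 < (\<epsilon> / 2)\<^sup>2"
  proof -
    have "2 * r * sqrt (real (2 * n + 1)) / \<epsilon> < real N"
      using fl unfolding N_def by linarith
    then have "2 * r * sqrt (real (2 * n + 1)) < real N * \<epsilon>"
      using \<epsilon> by (simp add: field_simps)
    then have "sqrt (real (2 * n + 1)) * (r / real N) < \<epsilon> / 2"
      using N0 by (simp add: field_simps)
    then have "(sqrt (real (2 * n + 1)) * (r / real N))\<^sup>2 < (\<epsilon> / 2)\<^sup>2"
      using r by (intro power_strict_mono) auto
    then show ?thesis by (simp only: power_mult_distrib real_sqrt_pow2 of_nat_0_le_iff)
  qed
  have "finite C" by (auto simp: C_def J intro!: finite_PiE)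
  moreover have "card C \<le> N ^ (2 * n + 1)"
  proof -
    have "card C \<le> card (J \<rightarrow>\<^sub>E {..<N})"
      unfolding C_def by (rule card_image_le) (auto simp: J intro!: finite_PiE)
    also have "\<dots> = N ^ (2 * n + 1)" using J by (simp add: card_PiE)
    finally show ?thesis .
  qed
  moreover have "S \<subseteq> (\<Union>c\<in>C. ball c \<epsilon>)"
  proof
    fix u assume u: "u \<in> S"
    have "\<exists>k<N. \<bar>coord u i - g k\<bar> \<le> r / real N" for i
      unfolding g_def using bd[OF u] abs_coord_le_norm[of u i] N0 by (intro grid_point) auto
    then obtain q where q: "\<And>i. q i < N" "\<And>i. \<bar>coord u i - g (q i)\<bar> \<le> r / real N" by metis
    define p where "p = restrict q J"
    have "(norm (u - c p))\<^sup>2 = (\<Sum>i\<in>J. (coord (u - c p) i)\<^sup>2)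
        + (\<Sum>\<^sub>\<infinity>i\<in>{i. \<bar>i\<bar> > int n}. (coord (u - c p) i)\<^sup>2)"
      unfolding J_def by (rule norm_ell2_sq_split)
    also have "(\<Sum>\<^sub>\<infinity>i\<in>{i. \<bar>i\<bar> > int n}. (coord (u - c p) i)\<^sup>2)
        = (\<Sum>\<^sub>\<infinity>i\<in>{i. \<bar>i\<bar> > int n}. (coord u i)\<^sup>2)"
      by (rule infsum_cong) (auto simp: coord_diff coord_c J_def)
    also have "(\<Sum>i\<in>J. (coord (u - c p) i)\<^sup>2) \<le> (\<Sum>i\<in>J. (r / real N)\<^sup>2)"
    proof (rule sum_mono)
      fix i assume "i \<in> J"
      then have "\<bar>coord (u - c p) i\<bar> \<le> \<bar>r / real N\<bar>"
        using q(2)[of i] r by (simp add: coord_diff coord_c p_def)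
      then show "(coord (u - c p) i)\<^sup>2 \<le> (r / real N)\<^sup>2" by (simp only: abs_le_square_iff)
    qed
    also have "(\<Sum>i\<in>J. (r / real N)\<^sup>2) = real (2 * n + 1) * (r / real N)\<^sup>2"
      using J by simp
    finally have "(norm (u - c p))\<^sup>2 < (\<epsilon> / 2)\<^sup>2 + (\<epsilon> / 2)\<^sup>2"
      using Nbig tail[OF u] by linarith
    also have "\<dots> \<le> \<epsilon>\<^sup>2" by (simp add: power2_eq_square)
    finally have "norm (u - c p) < \<epsilon>" using \<epsilon> by (simp add: power2_less_imp_less)
    moreover have "c p \<in> C" using q(1) by (auto simp: C_def p_def)
    ultimately show "u \<in> (\<Union>c\<in>C. ball c \<epsilon>)"
      by (auto simp: dist_norm norm_minus_commute intro!: bexI[of _ "c p"])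
  qed
  ultimately show ?thesis unfolding N_def by blast
qed

text \<open>A finite set carries the squared norm up to \<open>e\<close>, and so does any symmetric
  window of indices containing it; the rest is the tail.\<close>

lemma ell2_tail_small:
  assumes "0 < e"
  shows "\<exists>n. (\<Sum>\<^sub>\<infinity>i\<in>{i. \<bar>i\<bar> > int n}. (coord u i)\<^sup>2) \<le> e"
proof -
  obtain F where F: "finite F" "norm ((\<Sum>i\<in>F. (coord u i)\<^sup>2) - (norm u)\<^sup>2) \<le> e"
    using infsum_finite_approximation[OF summable_coord_sq assms, of u]
    by (auto simp: norm_ell2_sq dist_norm)
  \<comment> \<open>The inserted \<open>0\<close> gives \<open>Max\<close> a value when
    \<open>F\<close> is empty.\<close>
  define n where "n = nat (Max (insert 0 (abs ` F)))"
  have "\<bar>i\<bar> \<le> int n" if "i \<in> F" for i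
    using F that by (auto simp: n_def intro!: order.trans[OF Max_ge])
  then have "F \<subseteq> {- int n..int n}" by (auto simp: abs_le_iff) force
  then have "(\<Sum>i\<in>F. (coord u i)\<^sup>2) \<le> (\<Sum>i\<in>{- int n..int n}. (coord u i)\<^sup>2)"
    by (intro sum_mono2) auto
  then show ?thesis
    using F(2) norm_ell2_sq_split[of u n] by (intro exI[of _ n]) auto
qed

text \<open>For every \<open>e\<close>, each vector lies in some \<open>S r n e\<close>, a set of
  bounded norm and small tail that finitely many balls of radius \<open>1 / Suc e\<close> cover. The
  centres of all these covers together are dense. The dense set serves the measurability of
  distances to pullback images.\<close>

lemma ell2_separable: "\<exists>D :: ell2 set. countable D \<and> closure D = UNIV"
proof -
  define S where "S r n e = {u. norm u \<le> real r \<and>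
    (\<Sum>\<^sub>\<infinity>i\<in>{i. \<bar>i\<bar> > int n}. (coord u i)\<^sup>2) \<le> (1 / real (Suc e) / 2)\<^sup>2}" for r n e :: nat
  have "\<exists>C. finite C \<and> S r n e \<subseteq> (\<Union>c\<in>C. ball c (1 / real (Suc e)))" for r n e
  proof -
    have "\<exists>C. finite C \<and>
      card C \<le> nat (\<lfloor>2 * real r * sqrt (real (2 * n + 1)) / (1 / real (Suc e))\<rfloor> + 1) ^ (2 * n + 1) \<and>
      S r n e \<subseteq> (\<Union>c\<in>C. ball c (1 / real (Suc e)))"
      by (rule ell2_finite_cover) (auto simp: S_def)
    then show ?thesis by blast
  qed
  then obtain C where C: "\<And>r n e. finite (C r n e)"
    "\<And>r n e. S r n e \<subseteq> (\<Union>c\<in>C r n e. ball c (1 / real (Suc e)))" by metis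
  define D where "D = (\<Union>r n e. C r n e)"
  have "countable D" unfolding D_def by (intro countable_UN) (auto intro: countable_finite C)
  moreover have "u \<in> closure D" for u
  proof (subst closure_approachable, intro allI impI)
    fix x :: real assume "0 < x"
    then obtain e where e: "1 / real (Suc e) < x" using nat_approx_posE by blast
    obtain n where n: "(\<Sum>\<^sub>\<infinity>i\<in>{i. \<bar>i\<bar> > int n}. (coord u i)\<^sup>2) \<le> (1 / real (Suc e) / 2)\<^sup>2"
      using ell2_tail_small[of "(1 / real (Suc e) / 2)\<^sup>2" u] by auto
    obtain r where "norm u \<le> real r" using real_arch_simple by blast
    with n have "u \<in> S r n e" by (simp add: S_def)
    then obtain c where "c \<in> C r n e" "dist c u < 1 / real (Suc e)" using C(2) by fastforce
    then show "\<exists>y\<in>D. dist y u < x" using e by (intro bexI[of _ c]) (auto simp: D_def)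
  qed
  ultimately show ?thesis by blast
qed

lemma bounded_linear_coord: "bounded_linear (\<lambda>u. coord u i)"
  by (rule bounded_linear_intro[of _ 1])
    (auto simp: plus_ell2.rep_eq scaleR_ell2.rep_eq abs_coord_le_norm)

text \<open>The tail is the squared norm minus finitely many squared coordinates, hence continuous.
  Closedness is what carries a tail bound over to limit points.\<close>

lemma closed_tail_le: "closed {u. (\<Sum>\<^sub>\<infinity>i\<in>{i. \<bar>i\<bar> > int n}. (coord u i)\<^sup>2) \<le> c}"
proof -
  have "(\<Sum>\<^sub>\<infinity>i\<in>{i. \<bar>i\<bar> > int n}. (coord u i)\<^sup>2) =
      (norm u)\<^sup>2 - (\<Sum>i\<in>{- int n..int n}. (coord u i)\<^sup>2)" for u
    using norm_ell2_sq_split[of u n] by simp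
  then show ?thesis
    by (simp, intro closed_Collect_le continuous_intros
        bounded_linear.continuous_on[OF bounded_linear_coord])
qed

section \<open>Set norm, entropy and Hausdorff semi-distance\<close>

lemma norm_le_set_norm: "bounded D \<Longrightarrow> u \<in> D \<Longrightarrow> norm u \<le> set_norm D"
  unfolding set_norm_def bounded_iff by (intro cSUP_upper) (auto intro: bdd_aboveI2)

lemma set_norm_mono: "A \<subseteq> B \<Longrightarrow> A \<noteq> {} \<Longrightarrow> bounded B \<Longrightarrow> set_norm A \<le> set_norm B"
  unfolding set_norm_def bounded_iff by (intro cSUP_subset_mono) (auto intro: bdd_aboveI2)

lemma set_norm_nonneg: "bounded D \<Longrightarrow> D \<noteq> {} \<Longrightarrow> 0 \<le> set_norm D"
  using norm_le_set_norm norm_ge_zero order_trans by blast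

text \<open>A cover of a nonempty set is nonempty, so \<open>card C\<close> is admissible in the
  infimum. By well-ordering the infimum is attained at some \<open>n\<close> with
  \<open>1 \<le> n\<close>, where \<open>ln\<close> is monotone.\<close>

lemma kolmogorov_entropy_le:
  assumes "finite C" "Y \<subseteq> (\<Union>c\<in>C. ball c \<epsilon>)" "Y \<noteq> {}" "card C \<le> N ^ k"
  shows "kolmogorov_entropy \<epsilon> Y \<le> ereal (real k * ln (real N))"
proof -
  let ?S = "{enat n | n. n \<ge> 1 \<and> (\<exists>C. finite C \<and> card C = n \<and> Y \<subseteq> (\<Union>c\<in>C. ball c \<epsilon>))}"
  have "C \<noteq> {}" using assms by auto
  then have "1 \<le> card C" using assms(1) by (simp add: Suc_le_eq card_gt_0_iff)
  then have mem: "enat (card C) \<in> ?S" using assms by blast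
  then have "Inf ?S \<in> ?S" by (rule wellorder_InfI)
  then obtain n where n: "covering_number \<epsilon> Y = enat n" "1 \<le> n"
    unfolding covering_number_def by blast
  have "n \<le> card C"
    using Inf_lower[OF mem] n(1) by (simp add: covering_number_def)
  then have "real n \<le> real N ^ k" using assms(4) by (metis of_nat_le_iff of_nat_power order_trans)
  moreover from this have "0 < real N ^ k" using n(2) by linarith
  ultimately have "ln (real n) \<le> ln (real N ^ k)" using n(2) by (subst ln_le_cancel_iff) auto
  also have "\<dots> = real k * ln (real N)"
    by (rule ln_realpow)
  finally show ?thesis by (simp add: kolmogorov_entropy_def n(1))
qed

lemma hausdorff_semidist_tendsto_0:
  assumes "\<And>e. 0 < e \<Longrightarrow> \<forall>\<^sub>F t in F. \<forall>y\<in>Y t. infdist y Z < e"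
  shows "((\<lambda>t. hausdorff_semidist (Y t) Z) \<longlongrightarrow> 0) F"
proof (rule tendsto_zero_ennreal)
  fix r :: real assume "0 < r"
  \<comment> \<open>A supremum of values below \<open>r / 2\<close> may equal \<open>r / 2\<close>,
    which is still strictly below \<open>r\<close>.\<close>
  then have "\<forall>\<^sub>F t in F. \<forall>y\<in>Y t. infdist y Z < r / 2" using assms half_gt_zero by blast
  then show "\<forall>\<^sub>F t in F. hausdorff_semidist (Y t) Z < ennreal r"
  proof eventually_elim
    case (elim t)
    then have "hausdorff_semidist (Y t) Z \<le> ennreal (r / 2)"
      unfolding hausdorff_semidist_def by (intro SUP_least ennreal_leI) (simp add: less_imp_le)
    also have "\<dots> < ennreal r" using \<open>0 < r\<close> by (simp add: ennreal_less_iff)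
    finally show ?case .
  qed
qed

lemma subset_if_hausdorff_semidist_0:
  assumes "hausdorff_semidist Y Z = 0" "closed Z" "Z \<noteq> {}"
  shows "Y \<subseteq> Z"
proof
  fix y assume "y \<in> Y"
  then have "ennreal (infdist y Z) \<le> 0"
    unfolding assms(1)[symmetric] hausdorff_semidist_def by (rule SUP_upper)
  then have "infdist y Z = 0"
    using infdist_nonneg[of y Z] by (simp add: ennreal_eq_0_iff)
  then show "y \<in> Z" using assms by (simp add: in_closed_iff_infdist_zero)
qed

section \<open>Measurability\<close>

text \<open>The sublevel set \<open>{f w < a}\<close> is a union of balls centred in \<open>D\<close>; whether \<open>f w \<le> b\<close> on a ball is
  decided on \<open>D\<close>, and whether \<open>K w\<close> meets it by the distance to its centre. This avoids measurable
  selections.\<close>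

lemma borel_measurable_INF_dense:
  fixes f :: "'w \<Rightarrow> 'a::metric_space \<Rightarrow> real"
  assumes D: "countable D" "closure D = UNIV"
    and f: "\<And>d. d \<in> D \<Longrightarrow> (\<lambda>w. f w d) \<in> borel_measurable N"
    and cont: "\<And>w. w \<in> space N \<Longrightarrow> continuous_on UNIV (f w)"
    and K: "\<And>d. d \<in> D \<Longrightarrow> (\<lambda>w. infdist d (K w)) \<in> borel_measurable N"
    and ne: "\<And>w. w \<in> space N \<Longrightarrow> K w \<noteq> {}"
    and bdd: "\<And>w. w \<in> space N \<Longrightarrow> bdd_below (f w ` K w)"
  shows "(\<lambda>w. INF u\<in>K w. f w u) \<in> borel_measurable N"
proof (subst borel_measurable_iff_less, rule allI)
  fix a :: real
  define U where "U b d k = {w\<in>space N. infdist d (K w) < 1 / real (Suc k)} \<inter>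
    {w\<in>space N. \<forall>d'\<in>D. dist d d' < 1 / real (Suc k) \<longrightarrow> f w d' \<le> b}" for b :: real and d k
  have U: "U b d k \<in> sets N" if "d \<in> D" for b d k
    unfolding U_def using f K[OF that] D(1) by measurable
  have "{w \<in> space N. (INF u\<in>K w. f w u) < a} = (\<Union>b\<in>{b\<in>\<rat>. b < a}. \<Union>d\<in>D. \<Union>k. U b d k)"
  proof (intro equalityI subsetI)
    fix w assume "w \<in> {w \<in> space N. (INF u\<in>K w. f w u) < a}"
    then have w: "w \<in> space N" "(INF u\<in>K w. f w u) < a" by auto
    then obtain u where u: "u \<in> K w" "f w u < a"
      using ne bdd by (subst (asm) cINF_less_iff) auto
    \<comment> \<open>A rational level keeps the union over \<open>b\<close> countable; with
      \<open>b < a\<close>, the weak bound by \<open>b\<close> still yields the strict bound by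
      \<open>a\<close>.\<close>
    then obtain b where b: "b \<in> \<rat>" "f w u < b" "b < a" using Rats_dense_in_real by blast
    have "open {v. f w v < b}"
      by (intro open_Collect_less cont[OF w(1)] continuous_on_const)
    then obtain e where e: "0 < e" "\<And>v. dist v u < e \<Longrightarrow> f w v < b"
      using b(2) unfolding open_dist by blast
    \<comment> \<open>With \<open>d\<close> within \<open>1 / Suc k\<close> of \<open>u\<close>, the
      ball of that radius about \<open>d\<close> lies in the ball of radius \<open>e\<close> about
      \<open>u\<close>, where \<open>f w\<close> is below \<open>b\<close>.\<close>
    obtain k where k: "1 / real (Suc k) < e / 2" using e(1) nat_approx_posE half_gt_zero by blast
    have "u \<in> closure D" using D by simp
    then obtain d where d: "d \<in> D" "dist d u < 1 / real (Suc k)"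
      unfolding closure_approachable by (meson of_nat_0_less_iff zero_less_Suc zero_less_divide_1_iff)
    have "infdist d (K w) < 1 / real (Suc k)" using infdist_le[OF u(1), of d] d by linarith
    moreover have "f w d' \<le> b" if "dist d d' < 1 / real (Suc k)" for d'
      using dist_triangle[of d' u d] that d(2) k
      by (intro less_imp_le e(2)) (simp add: dist_commute)
    ultimately have "w \<in> U b d k" using w by (auto simp: U_def)
    then show "w \<in> (\<Union>b\<in>{b\<in>\<rat>. b < a}. \<Union>d\<in>D. \<Union>k. U b d k)" using b d by blast
  next
    fix w assume "w \<in> (\<Union>b\<in>{b\<in>\<rat>. b < a}. \<Union>d\<in>D. \<Union>k. U b d k)"
    then obtain b d k where b: "b < a" and d: "d \<in> D" and w: "w \<in> space N"
      "infdist d (K w) < 1 / real (Suc k)"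
      "\<And>d'. d' \<in> D \<Longrightarrow> dist d d' < 1 / real (Suc k) \<Longrightarrow> f w d' \<le> b"
      by (auto simp: U_def)
    obtain u where u: "u \<in> K w" "dist d u < 1 / real (Suc k)"
      using w(2) ne[OF w(1)] by (subst (asm) infdist_notempty, simp)
        (subst (asm) cINF_less_iff, auto)
    \<comment> \<open>The ball is open, so \<open>D\<close> is dense in it, and by continuity the
      bound known on \<open>D\<close> reaches \<open>u\<close>.\<close>
    have "u \<in> closure (D \<inter> ball d (1 / real (Suc k)))"
      using u(2) D(2) open_Int_closure_subset[of "ball d (1 / real (Suc k))" D]
      by (auto simp: Int_commute)
    moreover have "closed {v. f w v \<le> b}"
      by (intro closed_Collect_le cont[OF w(1)] continuous_on_const)
    moreover have "D \<inter> ball d (1 / real (Suc k)) \<subseteq> {v. f w v \<le> b}" using w(3) by auto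
    ultimately have "f w u \<le> b" using closure_minimal by blast
    then have "(INF u\<in>K w. f w u) \<le> b" using u bdd w by (meson cINF_lower2)
    then show "w \<in> {w \<in> space N. (INF u\<in>K w. f w u) < a}" using w b by auto
  qed
  also have "\<dots> \<in> sets N"
    using D(1) U by (intro sets.countable_UN'' sets.countable_UN countable_subset[OF _ countable_rat]) auto
  finally show "{w \<in> space N. (INF u\<in>K w. f w u) < a} \<in> sets N" .
qed

text \<open>A set of the completion is a measurable set plus part of a null set. Since the measure
  is preserved, the preimage of the null set is null again.\<close>

lemma measure_preserving_completion:
  assumes f: "f \<in> M \<rightarrow>\<^sub>M M" and "distr M M f = M"
  shows "f \<in> completion M \<rightarrow>\<^sub>M completion M"
proof (rule measurableI)
  fix x assume "x \<in> space (completion M)"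
  then show "f x \<in> space (completion M)" using measurable_space[OF f] by simp
next
  fix A assume "A \<in> sets (completion M)"
  then obtain S N N' where A: "A = S \<union> N" "N \<subseteq> N'" "N' \<in> null_sets M" "S \<in> sets M"
    by (rule sets_completionE)
  have N': "f -` N' \<inter> space M \<in> null_sets M"
  proof -
    have "emeasure M (f -` N' \<inter> space M) = emeasure (distr M M f) N'"
      using f A by (subst emeasure_distr) auto
    then show ?thesis using assms A by (auto intro!: null_setsI measurable_sets)
  qed
  show "f -` A \<inter> space (completion M) \<in> sets (completion M)"
  proof (rule sets_completionI[OF _ _ N'])
    show "f -` A \<inter> space (completion M) = (f -` S \<inter> space M) \<union> (f -` N \<inter> space M)"
      using A(1) by auto
    show "f -` N \<inter> space M \<subseteq> f -` N' \<inter> space M" using A(2) by auto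
    show "f -` S \<inter> space M \<in> sets M" using f A(4) by (rule measurable_sets)
  qed
qed

section \<open>Omega-limit sets\<close>

text \<open>Adding the finitely many early terms as centres makes the whole range totally bounded.
  Closed balls of radius \<open>e / 2\<close> also cover its closure and fit into open balls of
  radius \<open>e\<close>; completeness then gives compactness.\<close>

lemma convergent_subseq_if_eventually_totally_bounded:
  fixes y :: "nat \<Rightarrow> 'a::complete_space"
  assumes "\<And>e. 0 < e \<Longrightarrow> \<exists>C. finite C \<and> (\<forall>\<^sub>F n in sequentially. y n \<in> (\<Union>c\<in>C. ball c e))"
  obtains l r where "strict_mono (r :: nat \<Rightarrow> nat)" "(y \<circ> r) \<longlonglongrightarrow> l"
proof -
  have "compact (closure (range y))"
    unfolding compact_eq_totally_bounded complete_eq_closed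
  proof (intro conjI allI impI)
    show "closed (closure (range y))" by simp
    fix e :: real assume "0 < e"
    then obtain C where C: "finite C" "\<forall>\<^sub>F n in sequentially. y n \<in> (\<Union>c\<in>C. ball c (e / 2))"
      using assms[of "e / 2"] by auto
    then obtain n0 where n0: "\<And>n. n \<ge> n0 \<Longrightarrow> y n \<in> (\<Union>c\<in>C. ball c (e / 2))"
      unfolding eventually_sequentially by blast
    have "y n \<in> (\<Union>c\<in>C \<union> y ` {..<n0}. cball c (e / 2))" for n
    proof (cases "n < n0")
      case True
      then show ?thesis using \<open>0 < e\<close> by (intro UN_I[of "y n"]) auto
    next
      case False
      then obtain c where "c \<in> C" "y n \<in> ball c (e / 2)" using n0[of n] by auto
      then show ?thesis by (intro UN_I[of c]) auto
    qed
    then have "range y \<subseteq> (\<Union>c\<in>C \<union> y ` {..<n0}. cball c (e / 2))" by blast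
    moreover have "closed (\<Union>c\<in>C \<union> y ` {..<n0}. cball c (e / 2))" using C by (intro closed_UN) auto
    ultimately have "closure (range y) \<subseteq> (\<Union>c\<in>C \<union> y ` {..<n0}. cball c (e / 2))"
      by (rule closure_minimal)
    also have "\<dots> \<subseteq> (\<Union>c\<in>C \<union> y ` {..<n0}. ball c e)" using \<open>0 < e\<close> by force
    finally show "\<exists>k. finite k \<and> closure (range y) \<subseteq> (\<Union>x\<in>k. ball x e)" using C(1)
      by (intro exI[of _ "C \<union> y ` {..<n0}"]) auto
  qed
  then have "seq_compact (closure (range y))" by (simp add: compact_eq_seq_compact_metric)
  then show ?thesis using that closure_subset by (metis range_subsetD seq_compactE)
qed

definition omega_limit :: "(real \<Rightarrow> 'a::metric_space set) \<Rightarrow> 'a set" where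
  "omega_limit P = (\<Inter>\<tau>. closure (\<Union>t\<in>{\<tau>..}. P t))"

text \<open>The closures shrink as \<open>\<tau>\<close> grows, so early times do not affect the
  intersection. The formula for the attractor is therefore the same for every choice of absorption
  time.\<close>

lemma omega_limit_eq_INT_atLeast:
  "omega_limit P = (\<Inter>\<tau>\<in>{T..}. closure (\<Union>t\<in>{\<tau>..}. P t))"
proof (intro equalityI subsetI)
  fix x assume x: "x \<in> (\<Inter>\<tau>\<in>{T..}. closure (\<Union>t\<in>{\<tau>..}. P t))"
  have "x \<in> closure (\<Union>t\<in>{\<tau>..}. P t)" for \<tau>
  proof -
    have "x \<in> closure (\<Union>t\<in>{max \<tau> T..}. P t)" using x by auto
    moreover have "closure (\<Union>t\<in>{max \<tau> T..}. P t) \<subseteq> closure (\<Union>t\<in>{\<tau>..}. P t)"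
      by (intro closure_mono) auto
    ultimately show ?thesis by blast
  qed
  then show "x \<in> omega_limit P" by (simp add: omega_limit_def)
qed (auto simp: omega_limit_def)

lemma omega_limit_subset_closed:
  assumes "closed Z" "\<And>t. t \<ge> T \<Longrightarrow> P t \<subseteq> Z"
  shows "omega_limit P \<subseteq> Z"
proof -
  have "omega_limit P \<subseteq> closure (\<Union>t\<in>{T..}. P t)" by (auto simp: omega_limit_def)
  also have "\<dots> \<subseteq> Z" using assms by (intro closure_minimal) auto
  finally show ?thesis .
qed

text \<open>For each \<open>n\<close>, pick a point within \<open>1 / Suc n\<close> of
  \<open>x\<close> among the images at times from \<open>n\<close> on.\<close>

lemma omega_limitE:
  assumes "x \<in> omega_limit P"
  obtains t y where "\<And>n. t n \<ge> real n" "\<And>n. y n \<in> P (t n)" "y \<longlonglongrightarrow> x"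
proof -
  have "\<exists>t y. t \<ge> real n \<and> y \<in> P t \<and> dist y x < 1 / real (Suc n)" for n
  proof -
    have "x \<in> closure (\<Union>t\<in>{real n..}. P t)" using assms by (simp add: omega_limit_def)
    then have "\<exists>y\<in>(\<Union>t\<in>{real n..}. P t). dist y x < 1 / real (Suc n)"
      unfolding closure_approachable by (metis of_nat_0_less_iff zero_less_Suc zero_less_divide_1_iff)
    then show ?thesis by auto
  qed
  then obtain t y where ty: "\<And>n. t n \<ge> real n" "\<And>n. y n \<in> P (t n)"
    "\<And>n. dist (y n) x < 1 / real (Suc n)" by metis
  have "y \<longlonglongrightarrow> x"
    unfolding tendsto_dist_iff[of y]
    by (rule tendsto_sandwich[OF _ _ tendsto_const LIMSEQ_Suc[OF lim_1_over_n]])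
      (use ty(3) in \<open>auto intro!: always_eventually less_imp_le\<close>)
  then show ?thesis using that ty by blast
qed

lemma omega_limitI:
  assumes "filterlim t at_top sequentially" "\<And>n. y n \<in> P (t n)" "y \<longlonglongrightarrow> x"
  shows "x \<in> omega_limit P"
  unfolding omega_limit_def
proof
  fix \<tau> :: real
  have "\<forall>\<^sub>F n in sequentially. \<tau> \<le> t n" using assms(1) by (simp add: filterlim_at_top)
  then have "\<forall>\<^sub>F n in sequentially. y n \<in> closure (\<Union>t\<in>{\<tau>..}. P t)"
    by eventually_elim (use assms(2) closure_subset in fastforce)
  then show "x \<in> closure (\<Union>t\<in>{\<tau>..}. P t)"
    using assms(3) by (intro Lim_in_closed_set[of _ y sequentially]) auto
qed

text \<open>In a complete space this yields asymptotic compactness, and it is the form that finite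
  covers of late images deliver: the starting time may depend on \<open>e\<close>.\<close>

definition asymptotically_totally_bounded :: "(real \<Rightarrow> 'a::metric_space set) \<Rightarrow> bool" where
  "asymptotically_totally_bounded P \<longleftrightarrow>
     (\<forall>e>0. \<exists>C \<tau>. finite C \<and> (\<forall>t\<ge>\<tau>. P t \<subseteq> (\<Union>c\<in>C. ball c e)))"

text \<open>Late images have finite covers at every scale, so \<open>y\<close> has a convergent
  subsequence; the times still tend to infinity along it, which puts the limit into the omega-limit
  set.\<close>

lemma omega_limit_subseq:
  fixes P :: "real \<Rightarrow> 'a::complete_space set"
  assumes P: "asymptotically_totally_bounded P"
    and t: "filterlim t at_top sequentially" and y: "\<And>n. y n \<in> P (t n)"
  obtains r x where "strict_mono (r :: nat \<Rightarrow> nat)" "(y \<circ> r) \<longlonglongrightarrow> x" "x \<in> omega_limit P"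
proof -
  obtain r x where r: "strict_mono (r :: nat \<Rightarrow> nat)" "(y \<circ> r) \<longlonglongrightarrow> x"
  proof (rule convergent_subseq_if_eventually_totally_bounded[of y])
    fix e :: real assume "0 < e"
    then obtain C \<tau> where C: "finite C" "\<forall>t\<ge>\<tau>. P t \<subseteq> (\<Union>c\<in>C. ball c e)"
      using P unfolding asymptotically_totally_bounded_def by blast
    have "\<forall>\<^sub>F n in sequentially. \<tau> \<le> t n" using t by (simp add: filterlim_at_top)
    then have "\<forall>\<^sub>F n in sequentially. y n \<in> (\<Union>c\<in>C. ball c e)"
      by eventually_elim (use C(2) y in blast)
    then show "\<exists>C. finite C \<and> (\<forall>\<^sub>F n in sequentially. y n \<in> (\<Union>c\<in>C. ball c e))"
      using C(1) by blast
  qed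
  moreover have "x \<in> omega_limit P"
  proof (rule omega_limitI)
    show "filterlim (t \<circ> r) at_top sequentially"
      unfolding comp_def using t filterlim_subseq[OF r(1)] by (rule filterlim_compose)
  qed (use y r in auto)
  ultimately show ?thesis using that by blast
qed

lemma omega_limit_nonempty:
  fixes P :: "real \<Rightarrow> 'a::complete_space set"
  assumes "asymptotically_totally_bounded P" "\<And>t. P t \<noteq> {}"
  shows "omega_limit P \<noteq> {}"
proof -
  have "\<forall>n. \<exists>y. y \<in> P (real n)" using assms(2) by blast
  then obtain y where "\<And>n. y n \<in> P (real n)" by metis
  then show ?thesis
    using omega_limit_subseq[OF assms(1) filterlim_real_sequentially, of y] by blast
qed

lemma compact_omega_limit:
  fixes P :: "real \<Rightarrow> 'a::complete_space set"
  assumes "asymptotically_totally_bounded P"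
  shows "compact (omega_limit P)"
  unfolding compact_eq_totally_bounded complete_eq_closed
proof (intro conjI allI impI)
  show "closed (omega_limit P)" by (auto simp: omega_limit_def)
next
  fix e :: real assume "0 < e"
  then obtain C \<tau> where C: "finite C" "\<And>t. t \<ge> \<tau> \<Longrightarrow> P t \<subseteq> (\<Union>c\<in>C. ball c (e / 2))"
    using assms unfolding asymptotically_totally_bounded_def by (meson half_gt_zero)
  \<comment> \<open>A finite union of closed balls is closed, so it contains the omega-limit set
    along with the late images.\<close>
  have "omega_limit P \<subseteq> (\<Union>c\<in>C. cball c (e / 2))"
    using C by (intro omega_limit_subset_closed[of _ \<tau>] closed_UN) force+
  also have "\<dots> \<subseteq> (\<Union>c\<in>C. ball c e)" using \<open>0 < e\<close> by force
  finally show "\<exists>k. finite k \<and> omega_limit P \<subseteq> (\<Union>x\<in>k. ball x e)" using C(1) by blast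
qed

text \<open>Otherwise points at distance at least \<open>e\<close>, at times tending to infinity,
  would have a subsequence converging into the omega-limit set, contradicting the continuity of the
  distance.\<close>

lemma omega_limit_attracts:
  fixes P :: "real \<Rightarrow> 'a::complete_space set"
  assumes "asymptotically_totally_bounded P" "0 < e"
  shows "\<exists>\<tau>. \<forall>t\<ge>\<tau>. \<forall>y\<in>P t. infdist y (omega_limit P) < e"
proof (rule ccontr)
  assume "\<not> ?thesis"
  then have "\<exists>t y. t \<ge> real n \<and> y \<in> P t \<and> e \<le> infdist y (omega_limit P)" for n
    by (meson not_less)
  then obtain t y where ty: "\<And>n. t n \<ge> real n" "\<And>n. y n \<in> P (t n)"
    "\<And>n. e \<le> infdist (y n) (omega_limit P)" by metis
  have "filterlim t at_top sequentially"
    by (rule filterlim_at_top_mono[OF filterlim_real_sequentially]) (simp add: ty)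
  then obtain r x where r: "(y \<circ> r) \<longlonglongrightarrow> x" "x \<in> omega_limit P"
    using omega_limit_subseq[where y = y and t = t, OF assms(1) _ ty(2)] by blast
  then have "(\<lambda>n. infdist ((y \<circ> r) n) (omega_limit P)) \<longlonglongrightarrow> infdist x (omega_limit P)"
    by (intro tendsto_infdist)
  then have "e \<le> infdist x (omega_limit P)"
    by (rule tendsto_lowerbound) (auto simp: ty)
  then show False using r(2) assms(2) by simp
qed

section \<open>The attractor of an asymptotically null cocycle\<close>

locale absorbed_cocycle =
  fixes \<theta>1 :: "real \<Rightarrow> 'w1 \<Rightarrow> 'w1"
    and M :: "'w2 measure"
    and \<theta>2 :: "real \<Rightarrow> 'w2 \<Rightarrow> 'w2"
    and \<Phi> :: "real \<Rightarrow> 'w1 \<Rightarrow> 'w2 \<Rightarrow> ell2 \<Rightarrow> ell2"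
    and K :: "('w1, 'w2) family"
  assumes flow: "parametric_flow \<theta>1"
    and mds: "metric_dynamical_system M \<theta>2"
    and cocycle: "continuous_cocycle \<theta>1 M \<theta>2 \<Phi>"
    and absorbing: "closed_measurable_absorbing \<theta>1 M \<theta>2 \<Phi> K"
    and null: "asymptotically_null \<theta>1 M \<theta>2 \<Phi> K"
begin

section \<open>Identities for the flows, the cocycle and pullback images\<close>

lemma theta1: "\<theta>1 0 \<omega>1 = \<omega>1" "\<theta>1 t (\<theta>1 s \<omega>1) = \<theta>1 (s + t) \<omega>1"
  using flow by (auto simp: parametric_flow_def)

lemma theta2: "\<omega>2 \<in> space M \<Longrightarrow> \<theta>2 0 \<omega>2 = \<omega>2"
  "\<omega>2 \<in> space M \<Longrightarrow> \<theta>2 t (\<theta>2 s \<omega>2) = \<theta>2 (s + t) \<omega>2"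
  using mds by (auto simp: metric_dynamical_system_def)

lemma measurable_theta2: "\<theta>2 t \<in> M \<rightarrow>\<^sub>M M"
proof -
  have [measurable]: "(\<lambda>(t, \<omega>2). \<theta>2 t \<omega>2) \<in> borel \<Otimes>\<^sub>M M \<rightarrow>\<^sub>M M"
    using mds by (simp add: metric_dynamical_system_def)
  have "(\<lambda>\<omega>2. (\<lambda>(t, \<omega>2). \<theta>2 t \<omega>2) (t, \<omega>2)) \<in> M \<rightarrow>\<^sub>M M" by measurable
  then show ?thesis by simp
qed

lemma measurable_theta2_completion: "\<theta>2 t \<in> completion M \<rightarrow>\<^sub>M completion M"
  using mds by (intro measure_preserving_completion measurable_theta2)
    (auto simp: metric_dynamical_system_def)

lemma theta2_space [simp]: "\<omega>2 \<in> space M \<Longrightarrow> \<theta>2 t \<omega>2 \<in> space M"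
  using measurable_space[OF measurable_theta2] by blast

lemma Phi_continuous: "\<omega>2 \<in> space M \<Longrightarrow> 0 \<le> t \<Longrightarrow> continuous_on UNIV (\<Phi> t \<omega>1 \<omega>2)"
  using cocycle by (auto simp: continuous_cocycle_def)

lemma Phi_add: "\<omega>2 \<in> space M \<Longrightarrow> 0 \<le> t \<Longrightarrow> 0 \<le> s \<Longrightarrow>
    \<Phi> (t + s) \<omega>1 \<omega>2 = \<Phi> t (\<theta>1 s \<omega>1) (\<theta>2 s \<omega>2) \<circ> \<Phi> s \<omega>1 \<omega>2"
  using cocycle by (auto simp: continuous_cocycle_def)

lemma measurable_Phi:
  assumes "0 \<le> t" "f \<in> N \<rightarrow>\<^sub>M M"
  shows "(\<lambda>w. \<Phi> t \<omega>1 (f w) u) \<in> borel_measurable N"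
proof -
  have "(\<lambda>(t, \<omega>2, u). \<Phi> t \<omega>1 \<omega>2 u)
      \<in> restrict_space borel {0..} \<Otimes>\<^sub>M (M \<Otimes>\<^sub>M borel) \<rightarrow>\<^sub>M borel"
    using cocycle by (simp add: continuous_cocycle_def)
  moreover have "(\<lambda>w. (t, f w, u)) \<in> N \<rightarrow>\<^sub>M restrict_space borel {0..} \<Otimes>\<^sub>M (M \<Otimes>\<^sub>M borel)"
    using assms by (intro measurable_Pair measurable_const) (auto simp: space_restrict_space)
  ultimately have "(\<lambda>w. (\<lambda>(t, \<omega>2, u). \<Phi> t \<omega>1 \<omega>2 u) (t, f w, u)) \<in> borel_measurable N"
    by (rule measurable_compose_rev)
  then show ?thesis by simp
qed

abbreviation "pull \<equiv> pullback_image \<theta>1 \<theta>2 \<Phi>"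

text \<open>Starting \<open>t + s\<close> in the past and flowing for time \<open>t\<close> ends in
  the fibre \<open>s\<close> in the past; the cocycle law supplies the remaining stretch
  \<open>s\<close>.\<close>

lemma pull_add:
  assumes "\<omega>2 \<in> space M" "0 \<le> t" "0 \<le> s"
  shows "pull B \<omega>1 \<omega>2 (t + s) =
    \<Phi> s (\<theta>1 (- s) \<omega>1) (\<theta>2 (- s) \<omega>2) ` pull B (\<theta>1 (- s) \<omega>1) (\<theta>2 (- s) \<omega>2) t"
  using assms Phi_add[of "\<theta>2 (- (t + s)) \<omega>2" s t "\<theta>1 (- (t + s)) \<omega>1"]
  by (simp add: pullback_image_def theta1 theta2 image_comp add.commute)

lemma pull_shift:
  assumes "\<omega>2 \<in> space M" "0 \<le> t" "0 \<le> s"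
  shows "pull B (\<theta>1 s \<omega>1) (\<theta>2 s \<omega>2) (t + s) = \<Phi> s \<omega>1 \<omega>2 ` pull B \<omega>1 \<omega>2 t"
  using assms by (simp add: pull_add theta1 theta2)

section \<open>Absorption, small tails and asymptotic compactness\<close>

lemma K_tempered: "tempered \<theta>1 M \<theta>2 K"
  using absorbing by (simp add: closed_measurable_absorbing_def)

lemma K: "\<omega>2 \<in> space M \<Longrightarrow> K \<omega>1 \<omega>2 \<noteq> {}" "\<omega>2 \<in> space M \<Longrightarrow> bounded (K \<omega>1 \<omega>2)"
  "\<omega>2 \<in> space M \<Longrightarrow> closed (K \<omega>1 \<omega>2)"
  using absorbing by (auto simp: closed_measurable_absorbing_def tempered_def)

lemma absorbs:
  assumes "\<omega>2 \<in> space M" "tempered \<theta>1 M \<theta>2 B"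
  obtains T where "0 < T" "\<And>t. t \<ge> T \<Longrightarrow> pull B \<omega>1 \<omega>2 t \<subseteq> K \<omega>1 \<omega>2"
  using absorbing assms unfolding closed_measurable_absorbing_def absorbs_from_def by metis

lemma null_from_tail:
  assumes "null_from \<theta>1 \<theta>2 \<Phi> K \<omega>1 \<omega>2 \<epsilon> T n" "t \<ge> T" "u \<in> pull K \<omega>1 \<omega>2 t"
  shows "(\<Sum>\<^sub>\<infinity>i\<in>{i. \<bar>i\<bar> > int n}. (coord u i)\<^sup>2) \<le> \<epsilon>\<^sup>2"
proof -
  let ?\<Phi> = "\<Phi> t (\<theta>1 (- t) \<omega>1) (\<theta>2 (- t) \<omega>2)"
  let ?g = "\<lambda>v. ennreal (\<Sum>\<^sub>\<infinity>i\<in>{i. \<bar>i\<bar> > int n}. \<bar>coord (?\<Phi> v) i\<bar>\<^sup>2)"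
  obtain v where v: "v \<in> K (\<theta>1 (- t) \<omega>1) (\<theta>2 (- t) \<omega>2)" "u = ?\<Phi> v"
    using assms(3) by (auto simp: pullback_image_def)
  have "?g v \<le> (SUP v\<in>K (\<theta>1 (- t) \<omega>1) (\<theta>2 (- t) \<omega>2). ?g v)" using v(1) by (rule SUP_upper)
  also have "\<dots> \<le> ennreal (\<epsilon>\<^sup>2)" using assms(1,2) by (simp only: null_from_def)
  finally show ?thesis by (simp add: v(2))
qed

text \<open>After both the absorption time and the nullness time, all images share the norm bound of
  \<open>K\<close> and the tail bound at level \<open>e / 2\<close>, so one grid cover serves their
  union.\<close>

lemma pull_K_totally_bounded:
  assumes w: "\<omega>2 \<in> space M"
  shows "asymptotically_totally_bounded (pull K \<omega>1 \<omega>2)"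
  unfolding asymptotically_totally_bounded_def
proof (intro allI impI)
  fix e :: real assume e: "0 < e"
  then obtain T n where n: "null_from \<theta>1 \<theta>2 \<Phi> K \<omega>1 \<omega>2 (e / 2) T n"
    using null w unfolding asymptotically_null_def by (meson half_gt_zero)
  obtain T' where T': "\<And>t. t \<ge> T' \<Longrightarrow> pull K \<omega>1 \<omega>2 t \<subseteq> K \<omega>1 \<omega>2"
    using absorbs[OF w K_tempered] by blast
  define S where "S = (\<Union>t\<in>{max T T'..}. pull K \<omega>1 \<omega>2 t)"
  have "norm u \<le> set_norm (K \<omega>1 \<omega>2)" if "u \<in> S" for u
    using that T' norm_le_set_norm[OF K(2)[OF w]] unfolding S_def by fastforce
  moreover have "(\<Sum>\<^sub>\<infinity>i\<in>{i. \<bar>i\<bar> > int n}. (coord u i)\<^sup>2) \<le> (e / 2)\<^sup>2" if "u \<in> S" for u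
    using that null_from_tail[OF n] unfolding S_def by fastforce
  ultimately obtain C where "finite C" "S \<subseteq> (\<Union>c\<in>C. ball c e)"
    using ell2_finite_cover[OF e set_norm_nonneg[OF K(2)[OF w] K(1)[OF w]]] by meson
  then show "\<exists>C \<tau>. finite C \<and> (\<forall>t\<ge>\<tau>. pull K \<omega>1 \<omega>2 t \<subseteq> (\<Union>c\<in>C. ball c e))"
    unfolding S_def by (intro exI[of _ C] exI[of _ "max T T'"]) blast
qed

section \<open>The attractor: compactness, temperedness, invariance, attraction\<close>

definition attr :: "('w1, 'w2) family" where
  "attr \<omega>1 \<omega>2 = omega_limit (pull K \<omega>1 \<omega>2)"

lemma pull_nonempty: "\<omega>2 \<in> space M \<Longrightarrow> pull K \<omega>1 \<omega>2 t \<noteq> {}"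
  by (simp add: pullback_image_def K)

lemma attr_nonempty: "\<omega>2 \<in> space M \<Longrightarrow> attr \<omega>1 \<omega>2 \<noteq> {}"
  unfolding attr_def by (intro omega_limit_nonempty pull_K_totally_bounded pull_nonempty)

lemma compact_attr: "\<omega>2 \<in> space M \<Longrightarrow> compact (attr \<omega>1 \<omega>2)"
  unfolding attr_def by (intro compact_omega_limit pull_K_totally_bounded)

text \<open>\<open>K\<close> is tempered, so it absorbs itself; being closed, it keeps the limit
  points.\<close>

lemma attr_subset_K: "\<omega>2 \<in> space M \<Longrightarrow> attr \<omega>1 \<omega>2 \<subseteq> K \<omega>1 \<omega>2"
  unfolding attr_def by (metis absorbs K_tempered K(3) omega_limit_subset_closed)

lemma tempered_attr: "tempered \<theta>1 M \<theta>2 attr"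
  unfolding tempered_def
proof (intro allI ballI conjI impI)
  fix \<omega>1 \<omega>2 assume w: "\<omega>2 \<in> space M"
  show "attr \<omega>1 \<omega>2 \<noteq> {}" "bounded (attr \<omega>1 \<omega>2)"
    using attr_nonempty compact_attr compact_imp_bounded w by blast+
  fix \<gamma> :: real assume "0 < \<gamma>"
  then have K0: "((\<lambda>s. exp (- \<gamma> * s) * (set_norm (K (\<theta>1 (- s) \<omega>1) (\<theta>2 (- s) \<omega>2)))\<^sup>2) \<longlongrightarrow> 0) at_top"
    using K_tempered w unfolding tempered_def by blast
  show "((\<lambda>s. exp (- \<gamma> * s) * (set_norm (attr (\<theta>1 (- s) \<omega>1) (\<theta>2 (- s) \<omega>2)))\<^sup>2) \<longlongrightarrow> 0) at_top"
  proof (rule tendsto_sandwich[OF _ _ tendsto_const K0])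
    show "\<forall>\<^sub>F s in at_top. exp (- \<gamma> * s) * (set_norm (attr (\<theta>1 (- s) \<omega>1) (\<theta>2 (- s) \<omega>2)))\<^sup>2
        \<le> exp (- \<gamma> * s) * (set_norm (K (\<theta>1 (- s) \<omega>1) (\<theta>2 (- s) \<omega>2)))\<^sup>2"
      using w by (intro always_eventually allI mult_left_mono power_mono set_norm_mono
          set_norm_nonneg attr_subset_K attr_nonempty K compact_imp_bounded compact_attr) auto
  qed simp
qed

text \<open>Forward, continuity maps a sequence defining an omega-limit point to another such
  sequence. Backward, late points are images under \<open>\<Phi> s\<close> of points at times
  earlier by \<open>s\<close>; asymptotic compactness gives those a convergent subsequence, whose
  limit is the required preimage.\<close>

lemma attr_invariant:
  assumes w: "\<omega>2 \<in> space M" and s: "0 \<le> s"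
  shows "\<Phi> s \<omega>1 \<omega>2 ` attr \<omega>1 \<omega>2 = attr (\<theta>1 s \<omega>1) (\<theta>2 s \<omega>2)"
proof (intro equalityI subsetI)
  note cont = continuous_on_tendsto_compose[OF Phi_continuous[OF w s] _ UNIV_I]
  fix v assume "v \<in> \<Phi> s \<omega>1 \<omega>2 ` attr \<omega>1 \<omega>2"
  then obtain u where u: "u \<in> attr \<omega>1 \<omega>2" "v = \<Phi> s \<omega>1 \<omega>2 u" by blast
  then obtain t y where t: "\<And>n. t n \<ge> real n" and y: "\<And>n. y n \<in> pull K \<omega>1 \<omega>2 (t n)" "y \<longlonglongrightarrow> u"
    unfolding attr_def using omega_limitE by metis
  have t0: "0 \<le> t n" for n using t[of n] by linarith
  show "v \<in> attr (\<theta>1 s \<omega>1) (\<theta>2 s \<omega>2)"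
    unfolding attr_def
  proof (rule omega_limitI)
    show "filterlim (\<lambda>n. t n + s) at_top sequentially"
      by (rule filterlim_at_top_mono[OF filterlim_real_sequentially])
        (use t s in \<open>simp add: add_increasing2\<close>)
    show "\<Phi> s \<omega>1 \<omega>2 (y n) \<in> pull K (\<theta>1 s \<omega>1) (\<theta>2 s \<omega>2) (t n + s)" for n
      using y(1) pull_shift[OF w t0 s] by simp
    show "(\<lambda>n. \<Phi> s \<omega>1 \<omega>2 (y n)) \<longlonglongrightarrow> v" unfolding u(2) by (rule cont[OF y(2)]) simp
  qed
next
  note cont = continuous_on_tendsto_compose[OF Phi_continuous[OF w s] _ UNIV_I]
  fix v assume "v \<in> attr (\<theta>1 s \<omega>1) (\<theta>2 s \<omega>2)"
  then obtain t y where t: "\<And>n. t n \<ge> real n"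
    and y: "\<And>n. y n \<in> pull K (\<theta>1 s \<omega>1) (\<theta>2 s \<omega>2) (t n)" "y \<longlonglongrightarrow> v"
    unfolding attr_def using omega_limitE by metis
  \<comment> \<open>Skipping the first \<open>m\<close> terms keeps the times reduced by
    \<open>s\<close> nonnegative, as the cocycle law requires.\<close>
  obtain m where m: "s \<le> real m" using real_arch_simple by blast
  have tm: "0 \<le> t (n + m) - s" for n using t[of "n + m"] m by simp
  have "y (n + m) \<in> \<Phi> s \<omega>1 \<omega>2 ` pull K \<omega>1 \<omega>2 (t (n + m) - s)" for n
    using y(1)[of "n + m"] pull_shift[OF w tm s] by simp
  then obtain z where z: "\<And>n. z n \<in> pull K \<omega>1 \<omega>2 (t (n + m) - s)"
    "\<And>n. y (n + m) = \<Phi> s \<omega>1 \<omega>2 (z n)" unfolding image_iff by metis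
  have "filterlim (\<lambda>n. t (n + m) - s) at_top sequentially"
  proof (rule filterlim_at_top_mono[OF filterlim_real_sequentially])
    show "\<forall>\<^sub>F n in sequentially. real n \<le> t (n + m) - s"
    proof (rule always_eventually, rule allI)
      fix n show "real n \<le> t (n + m) - s" using t[of "n + m"] m by simp
    qed
  qed
  then obtain r u where r: "strict_mono (r :: nat \<Rightarrow> nat)" "(z \<circ> r) \<longlonglongrightarrow> u" "u \<in> attr \<omega>1 \<omega>2"
    using omega_limit_subseq[where y = z and t = "\<lambda>n. t (n + m) - s",
        OF pull_K_totally_bounded[OF w] _ z(1)]
    unfolding attr_def by blast
  have "(\<lambda>n. \<Phi> s \<omega>1 \<omega>2 ((z \<circ> r) n)) \<longlonglongrightarrow> \<Phi> s \<omega>1 \<omega>2 u" by (rule cont[OF r(2)]) simp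
  moreover have "(\<lambda>n. \<Phi> s \<omega>1 \<omega>2 ((z \<circ> r) n)) \<longlonglongrightarrow> v"
    using LIMSEQ_subseq_LIMSEQ[OF LIMSEQ_ignore_initial_segment[OF y(2), of m] r(1)]
    by (simp add: comp_def z(2))
  ultimately show "v \<in> \<Phi> s \<omega>1 \<omega>2 ` attr \<omega>1 \<omega>2" using r(3) LIMSEQ_unique by blast
qed

text \<open>Split the time as \<open>(t - s) + s\<close>. A fixed \<open>s\<close> for which the
  image of \<open>K\<close> is \<open>e\<close>-close to the attractor is chosen first; then
  \<open>B\<close> is absorbed by \<open>K\<close> in the fibre \<open>s\<close> in the past, and
  the last stretch carries it close to the attractor.\<close>

lemma attr_attracts:
  assumes w: "\<omega>2 \<in> space M" and B: "tempered \<theta>1 M \<theta>2 B"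
  shows "((\<lambda>t. hausdorff_semidist (pull B \<omega>1 \<omega>2 t) (attr \<omega>1 \<omega>2)) \<longlongrightarrow> 0) at_top"
proof (rule hausdorff_semidist_tendsto_0)
  fix e :: real assume "0 < e"
  then obtain \<tau> where \<tau>: "\<And>t y. t \<ge> \<tau> \<Longrightarrow> y \<in> pull K \<omega>1 \<omega>2 t \<Longrightarrow> infdist y (attr \<omega>1 \<omega>2) < e"
    using omega_limit_attracts[OF pull_K_totally_bounded[OF w]] unfolding attr_def by blast
  \<comment> \<open>The cocycle law is only available for nonnegative times.\<close>
  define s where "s = max 0 \<tau>"
  obtain T where T: "0 < T" "\<And>t. t \<ge> T \<Longrightarrow>
      pull B (\<theta>1 (- s) \<omega>1) (\<theta>2 (- s) \<omega>2) t \<subseteq> K (\<theta>1 (- s) \<omega>1) (\<theta>2 (- s) \<omega>2)"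
    using absorbs[OF _ B, of "\<theta>2 (- s) \<omega>2" "\<theta>1 (- s) \<omega>1"] w by auto
  show "\<forall>\<^sub>F t in at_top. \<forall>y\<in>pull B \<omega>1 \<omega>2 t. infdist y (attr \<omega>1 \<omega>2) < e"
    using eventually_ge_at_top[of "T + s"]
  proof eventually_elim
    case (elim t)
    have "pull B (\<theta>1 (- s) \<omega>1) (\<theta>2 (- s) \<omega>2) (t - s) \<subseteq> K (\<theta>1 (- s) \<omega>1) (\<theta>2 (- s) \<omega>2)"
      using T(2) elim by simp
    moreover have "pull B \<omega>1 \<omega>2 ((t - s) + s) = \<Phi> s (\<theta>1 (- s) \<omega>1) (\<theta>2 (- s) \<omega>2) `
        pull B (\<theta>1 (- s) \<omega>1) (\<theta>2 (- s) \<omega>2) (t - s)"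
      by (rule pull_add) (use T(1) elim w in \<open>auto simp: s_def\<close>)
    ultimately have "pull B \<omega>1 \<omega>2 t \<subseteq> pull K \<omega>1 \<omega>2 s"
      unfolding pullback_image_def[of _ _ _ K] by (auto intro: image_mono)
    then show ?case using \<tau>[of s] by (auto simp: s_def)
  qed
qed

section \<open>Measurability of the attractor\<close>

lemma invariant_eq_pull:
  assumes "\<And>\<omega>1 \<omega>2 t. \<omega>2 \<in> space M \<Longrightarrow> 0 \<le> t \<Longrightarrow> \<Phi> t \<omega>1 \<omega>2 ` B \<omega>1 \<omega>2 = B (\<theta>1 t \<omega>1) (\<theta>2 t \<omega>2)"
    and "\<omega>2 \<in> space M" "0 \<le> t"
  shows "pull B \<omega>1 \<omega>2 t = B \<omega>1 \<omega>2"
  using assms by (simp add: pullback_image_def theta1 theta2)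

text \<open>The distance to the image is an infimum over \<open>K\<close> in the shifted fibre of a
  function continuous in \<open>u\<close>. The shift respects the completion because
  \<open>\<theta>2\<close> preserves the measure.\<close>

lemma infdist_pull_measurable:
  assumes t: "0 \<le> t"
  shows "(\<lambda>\<omega>2. infdist x (pull K \<omega>1 \<omega>2 t)) \<in> borel_measurable (completion M)"
proof -
  obtain D :: "ell2 set" where D: "countable D" "closure D = UNIV" using ell2_separable by blast
  let ?\<Phi> = "\<lambda>\<omega>2. \<Phi> t (\<theta>1 (- t) \<omega>1) (\<theta>2 (- t) \<omega>2)"
  have "(\<lambda>\<omega>2. INF u\<in>K (\<theta>1 (- t) \<omega>1) (\<theta>2 (- t) \<omega>2). dist x (?\<Phi> \<omega>2 u))
      \<in> borel_measurable (completion M)"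
  proof (rule borel_measurable_INF_dense[OF D])
    fix d
    have "(\<lambda>\<omega>2. ?\<Phi> \<omega>2 d) \<in> borel_measurable (completion M)"
      by (intro measurable_Phi t measurable_completion measurable_theta2)
    moreover have "(\<lambda>y. dist x y) \<in> borel_measurable borel"
      by (intro borel_measurable_continuous_onI continuous_intros)
    ultimately show "(\<lambda>\<omega>2. dist x (?\<Phi> \<omega>2 d)) \<in> borel_measurable (completion M)"
      by (rule measurable_compose)
    show "(\<lambda>\<omega>2. infdist d (K (\<theta>1 (- t) \<omega>1) (\<theta>2 (- t) \<omega>2))) \<in> borel_measurable (completion M)"
      using absorbing unfolding closed_measurable_absorbing_def completion_measurable_def
      by (intro measurable_compose[OF measurable_theta2_completion]) auto
  next
    fix \<omega>2 assume "\<omega>2 \<in> space (completion M)"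
    then have w: "\<omega>2 \<in> space M" by simp
    show "continuous_on UNIV (\<lambda>u. dist x (?\<Phi> \<omega>2 u))"
      using w t by (intro continuous_intros Phi_continuous) auto
    show "K (\<theta>1 (- t) \<omega>1) (\<theta>2 (- t) \<omega>2) \<noteq> {}" using w by (simp add: K)
    show "bdd_below ((\<lambda>u. dist x (?\<Phi> \<omega>2 u)) ` K (\<theta>1 (- t) \<omega>1) (\<theta>2 (- t) \<omega>2))"
      by (rule bdd_belowI2[of _ 0]) simp
  qed
  moreover have "infdist x (pull K \<omega>1 \<omega>2 t) =
      (INF u\<in>K (\<theta>1 (- t) \<omega>1) (\<theta>2 (- t) \<omega>2). dist x (?\<Phi> \<omega>2 u))"
    if "\<omega>2 \<in> space (completion M)" for \<omega>2
    using that pull_nonempty[of \<omega>2 \<omega>1 t]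
    by (simp add: infdist_notempty pullback_image_def image_image)
  ultimately show ?thesis by (subst measurable_cong) auto
qed

lemma attr_measurable: "completion_measurable M attr"
  unfolding completion_measurable_def
proof (intro allI, rule borel_measurable_LIMSEQ_real)
  fix x \<omega>1 and m :: nat
  show "(\<lambda>\<omega>2. infdist x (pull K \<omega>1 \<omega>2 (real m))) \<in> borel_measurable (completion M)"
    by (rule infdist_pull_measurable) simp
next
  fix x \<omega>1 \<omega>2 assume "\<omega>2 \<in> space (completion M)"
  then have w: "\<omega>2 \<in> space M" by simp
  show "(\<lambda>m. infdist x (pull K \<omega>1 \<omega>2 (real m))) \<longlonglongrightarrow> infdist x (attr \<omega>1 \<omega>2)"
  proof (rule LIMSEQ_I)
    fix e :: real assume e: "0 < e"
    then obtain \<tau> where \<tau>: "\<And>t y. t \<ge> \<tau> \<Longrightarrow> y \<in> pull K \<omega>1 \<omega>2 t \<Longrightarrow> infdist y (attr \<omega>1 \<omega>2) < e / 2"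
      using omega_limit_attracts[OF pull_K_totally_bounded[OF w], of "e / 2"]
      unfolding attr_def by (meson half_gt_zero)
    obtain m0 where m0: "\<tau> \<le> real m0" using real_arch_simple by blast
    have "norm (infdist x (pull K \<omega>1 \<omega>2 (real m)) - infdist x (attr \<omega>1 \<omega>2)) < e" if "m \<ge> m0" for m
    proof -
      let ?P = "pull K \<omega>1 \<omega>2 (real m)"
      have "pull attr \<omega>1 \<omega>2 (real m) = attr \<omega>1 \<omega>2"
        by (rule invariant_eq_pull) (use attr_invariant w in auto)
      \<comment> \<open>The attractor is the image of itself in the fibre at time
        \<open>- m\<close>, where it lies inside \<open>K\<close>.\<close>
      then have "attr \<omega>1 \<omega>2 \<subseteq> ?P"
        unfolding pullback_image_def
        using image_mono[OF attr_subset_K[OF theta2_space[OF w]]] by metis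
      then have 1: "infdist x ?P \<le> infdist x (attr \<omega>1 \<omega>2)"
        using attr_nonempty[OF w] by (intro infdist_mono)
      \<comment> \<open>All image points are within \<open>e / 2\<close> of the attractor, so
        passing to the image lowers the distance from \<open>x\<close> by at most
        \<open>e / 2\<close>.\<close>
      have "infdist x (attr \<omega>1 \<omega>2) - e / 2 \<le> dist x y" if y: "y \<in> ?P" for y
        using infdist_triangle[of x "attr \<omega>1 \<omega>2" y] \<tau>[OF _ y] m0 \<open>m \<ge> m0\<close> by simp
      then have "infdist x (attr \<omega>1 \<omega>2) - e / 2 \<le> infdist x ?P"
        using pull_nonempty[OF w] by (subst (2) infdist_notempty) (auto intro: cINF_greatest)
      then show ?thesis using 1 e by (simp add: abs_if)
    qed
    then show "\<exists>m0. \<forall>m\<ge>m0. norm (infdist x (pull K \<omega>1 \<omega>2 (real m)) - infdist x (attr \<omega>1 \<omega>2)) < e"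
      by blast
  qed
qed

section \<open>Existence, uniqueness and the entropy bound\<close>

lemma pullback_attractor_attr: "pullback_attractor \<theta>1 M \<theta>2 \<Phi> attr"
  unfolding pullback_attractor_def
  using tempered_attr attr_measurable compact_attr attr_invariant attr_attracts by blast

text \<open>\<open>A\<close> is tempered, so \<open>A'\<close> attracts it. By invariance its
  pullback images are constantly \<open>A\<close>, so the semi-distance is a constant tending to
  zero. Exchanging the roles gives uniqueness.\<close>

lemma pullback_attractor_subset:
  assumes A: "pullback_attractor \<theta>1 M \<theta>2 \<Phi> A" and A': "pullback_attractor \<theta>1 M \<theta>2 \<Phi> A'"
    and w: "\<omega>2 \<in> space M"
  shows "A \<omega>1 \<omega>2 \<subseteq> A' \<omega>1 \<omega>2"
proof (rule subset_if_hausdorff_semidist_0)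
  have "((\<lambda>t. hausdorff_semidist (pull A \<omega>1 \<omega>2 t) (A' \<omega>1 \<omega>2)) \<longlongrightarrow> 0) at_top"
    using A A' w unfolding pullback_attractor_def by blast
  moreover have "pull A \<omega>1 \<omega>2 t = A \<omega>1 \<omega>2" if "0 \<le> t" for t
    by (rule invariant_eq_pull) (use A w that in \<open>auto simp: pullback_attractor_def\<close>)
  then have "\<forall>\<^sub>F t in at_top. hausdorff_semidist (pull A \<omega>1 \<omega>2 t) (A' \<omega>1 \<omega>2)
      = hausdorff_semidist (A \<omega>1 \<omega>2) (A' \<omega>1 \<omega>2)"
    by (intro eventually_mono[OF eventually_ge_at_top[of 0]]) simp
  ultimately have "((\<lambda>t :: real. hausdorff_semidist (A \<omega>1 \<omega>2) (A' \<omega>1 \<omega>2)) \<longlongrightarrow> 0) at_top"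
    by (rule Lim_transform_eventually)
  then show "hausdorff_semidist (A \<omega>1 \<omega>2) (A' \<omega>1 \<omega>2) = 0"
    by (simp add: tendsto_const_iff)
  show "closed (A' \<omega>1 \<omega>2)" "A' \<omega>1 \<omega>2 \<noteq> {}"
    using A' w unfolding pullback_attractor_def tempered_def by (auto intro: compact_imp_closed)
qed

text \<open>The tail bound of the late images is a closed condition and thus holds on the attractor,
  whose norm is bounded through \<open>K\<close>; one grid cover then gives the count. Nullness
  enters at level \<open>\<epsilon> / 2\<close> because the grid error takes up the other half of
  the tolerance.\<close>

lemma entropy_attr:
  assumes w: "\<omega>2 \<in> space M" and \<epsilon>: "0 < \<epsilon>"
    and n: "null_from \<theta>1 \<theta>2 \<Phi> K \<omega>1 \<omega>2 (\<epsilon> / 2) T n"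
  shows "kolmogorov_entropy \<epsilon> (attr \<omega>1 \<omega>2) \<le> ereal (real (2 * n + 1) *
    ln (real_of_int (\<lfloor>2 * set_norm (K \<omega>1 \<omega>2) * sqrt (real (2 * n + 1)) / \<epsilon>\<rfloor> + 1)))"
proof -
  let ?N = "\<lfloor>2 * set_norm (K \<omega>1 \<omega>2) * sqrt (real (2 * n + 1)) / \<epsilon>\<rfloor> + 1"
  have r: "0 \<le> set_norm (K \<omega>1 \<omega>2)" using w by (intro set_norm_nonneg K)
  have "attr \<omega>1 \<omega>2 \<subseteq> {u. (\<Sum>\<^sub>\<infinity>i\<in>{i. \<bar>i\<bar> > int n}. (coord u i)\<^sup>2) \<le> (\<epsilon> / 2)\<^sup>2}"
    unfolding attr_def by (intro omega_limit_subset_closed[of _ T] closed_tail_le)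
      (use null_from_tail[OF n] in auto)
  moreover have "norm u \<le> set_norm (K \<omega>1 \<omega>2)" if "u \<in> attr \<omega>1 \<omega>2" for u
    using that attr_subset_K[OF w] norm_le_set_norm[OF K(2)[OF w]] by blast
  ultimately obtain C where "finite C" "card C \<le> nat ?N ^ (2 * n + 1)"
    "attr \<omega>1 \<omega>2 \<subseteq> (\<Union>c\<in>C. ball c \<epsilon>)"
    using ell2_finite_cover[OF \<epsilon> r, of "attr \<omega>1 \<omega>2" n] by blast
  then have "kolmogorov_entropy \<epsilon> (attr \<omega>1 \<omega>2) \<le> ereal (real (2 * n + 1) * ln (real (nat ?N)))"
    using attr_nonempty[OF w] by (intro kolmogorov_entropy_le)
  moreover have "0 \<le> ?N" using r \<epsilon> by simp
  ultimately show ?thesis by (simp only: of_nat_nat)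
qed

end

theorem theorem3p2:
  fixes \<theta>1 :: "real \<Rightarrow> 'w1 \<Rightarrow> 'w1"
    and M :: "'w2 measure"
    and \<theta>2 :: "real \<Rightarrow> 'w2 \<Rightarrow> 'w2"
    and \<Phi> :: "real \<Rightarrow> 'w1 \<Rightarrow> 'w2 \<Rightarrow> ell2 \<Rightarrow> ell2"
    and K :: "('w1, 'w2) family"
  assumes "parametric_flow \<theta>1"
    and "metric_dynamical_system M \<theta>2"
    and "continuous_cocycle \<theta>1 M \<theta>2 \<Phi>"
    and "closed_measurable_absorbing \<theta>1 M \<theta>2 \<Phi> K"
    and "asymptotically_null \<theta>1 M \<theta>2 \<Phi> K"
  shows "\<exists>A. pullback_attractor \<theta>1 M \<theta>2 \<Phi> A \<and>
           (\<forall>A'. pullback_attractor \<theta>1 M \<theta>2 \<Phi> A' \<longrightarrow>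
              (\<forall>\<omega>1. \<forall>\<omega>2\<in>space M. A' \<omega>1 \<omega>2 = A \<omega>1 \<omega>2)) \<and>
           (\<forall>\<omega>1. \<forall>\<omega>2\<in>space M. \<forall>T\<^sub>K. absorbs_from \<theta>1 \<theta>2 \<Phi> K K \<omega>1 \<omega>2 T\<^sub>K \<longrightarrow>
              A \<omega>1 \<omega>2 = (\<Inter>\<tau>\<in>{T\<^sub>K..}. closure (\<Union>t\<in>{\<tau>..}. pullback_image \<theta>1 \<theta>2 \<Phi> K \<omega>1 \<omega>2 t))) \<and>
           (\<forall>\<omega>1. \<forall>\<omega>2\<in>space M. \<forall>\<epsilon>>0. \<forall>T I\<^sub>0. null_from \<theta>1 \<theta>2 \<Phi> K \<omega>1 \<omega>2 (\<epsilon> / 2) T I\<^sub>0 \<longrightarrow>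
              kolmogorov_entropy \<epsilon> (A \<omega>1 \<omega>2)
                \<le> ereal (real (2 * I\<^sub>0 + 1) *
                    ln (real_of_int
                      (\<lfloor>2 * set_norm (K \<omega>1 \<omega>2) * sqrt (real (2 * I\<^sub>0 + 1)) / \<epsilon>\<rfloor> + 1))))"
proof -
  interpret absorbed_cocycle \<theta>1 M \<theta>2 \<Phi> K using assms by unfold_locales
  show ?thesis
  proof (intro exI[of _ attr] conjI allI ballI impI)
    show "pullback_attractor \<theta>1 M \<theta>2 \<Phi> attr" by (rule pullback_attractor_attr)
  next
    fix A' \<omega>1 \<omega>2 assume "pullback_attractor \<theta>1 M \<theta>2 \<Phi> A'" "\<omega>2 \<in> space M"
    then show "A' \<omega>1 \<omega>2 = attr \<omega>1 \<omega>2"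
      using pullback_attractor_subset pullback_attractor_attr by (intro equalityI)
  next
    fix \<omega>1 \<omega>2 T\<^sub>K
    show "attr \<omega>1 \<omega>2 = (\<Inter>\<tau>\<in>{T\<^sub>K..}. closure (\<Union>t\<in>{\<tau>..}. pull K \<omega>1 \<omega>2 t))"
      unfolding attr_def by (rule omega_limit_eq_INT_atLeast)
  next
    fix \<omega>1 \<omega>2 and \<epsilon> :: real and T I\<^sub>0
    assume "\<omega>2 \<in> space M" "0 < \<epsilon>" "null_from \<theta>1 \<theta>2 \<Phi> K \<omega>1 \<omega>2 (\<epsilon> / 2) T I\<^sub>0"
    then show "kolmogorov_entropy \<epsilon> (attr \<omega>1 \<omega>2) \<le> ereal (real (2 * I\<^sub>0 + 1) *
        ln (real_of_int (\<lfloor>2 * set_norm (K \<omega>1 \<omega>2) * sqrt (real (2 * I\<^sub>0 + 1)) / \<epsilon>\<rfloor> + 1)))"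
      by (rule entropy_attr)
  qed
qed

end
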